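(* Let $\mathcal{H}$ be a complex Hilbert space, let $a,b\in\mathcal{H}$ and let $\rho>0$ be a real number. Then \[ \omega_\rho(a\otimes b)=\frac{1}{\rho}\|a\|\,\|b\|+\left|1-\frac{1}{\rho}\right||\langle a,b\rangle|, \] where $\omega_\rho$ denotes the $\rho$-numerical radius and $a\otimes b$ is the rank (at most) one operator $x\mapsto\langle x,a\rangle\,b$ on $\mathcal{H}$.
   Context: The inner product $\langle\cdot,\cdot\rangle$ of $\mathcal{H}$ is linear in the first argument, and $\mathfrak{B}(\mathcal{H})$ denotes the algebra of bounded linear operators on $\mathcal{H}$. For $a,b\in\mathcal{H}$, the operator $a\otimes b\in\mathfrak{B}(\mathcal{H})$ is defined by $(a\otimes b)x=\langle x,a\rangle\,b$ for $x\in\mathcal{H}$. For $\rho>0$, an operator $T\in\mathfrak{B}(\mathcal{H})$ is called a $\rho$-contraction if there exist a Hilbert space $\mathcal{K}\supseteq\mathcal{H}$ (containing $\mathcal{H}$ as a closed subspace) and a unitary operator $U\in\mathfrak{B}(\mathcal{K})$ such that $T^n h=\rho P_{\mathcal{H}}U^n h$ for all $h\in\mathcal{H}$ and all $n=1,2,\ldots$, where $P_{\mathcal{H}}$ is the orthogonal projection from $\mathcal{K}$ onto $\mathcal{H}$. The $\rho$-numerical radius of $T\in\mathfrak{B}(\mathcal{H})$ is \[ \omega_\rho(T)=\inf\left\{u>0:\tfrac{1}{u}T\text{ is a }\rho\text{-contraction}\right\}. \] *)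

theory Defs
  imports Complex_Main "HOL-Library.Function_Algebras"
begin

text \<open>
  Hilbert spaces are carrier-based, because the definition of a \<open>\<rho>\<close>-contraction quantifies
  existentially over the dilation space, which a type class would not allow.  The additive
  structure is that of the ambient type.
\<close>

record 'v hspace =
  hcarrier :: "'v set"
  hscale :: "complex \<Rightarrow> 'v \<Rightarrow> 'v"
  hinner :: "'v \<Rightarrow> 'v \<Rightarrow> complex"

definition hnorm :: "'v hspace \<Rightarrow> 'v \<Rightarrow> real" where
  "hnorm H x = sqrt (Re (hinner H x x))"

locale complex_hilbert_space =
  fixes H :: "'v::ab_group_add hspace"
  assumes scale: "vector_space (hscale H)"
    and subspace: "module.subspace (hscale H) (hcarrier H)"
    and inner_add: "\<lbrakk>x \<in> hcarrier H; y \<in> hcarrier H; z \<in> hcarrier H\<rbrakk>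
      \<Longrightarrow> hinner H (x + y) z = hinner H x z + hinner H y z"
    and inner_scale: "\<lbrakk>x \<in> hcarrier H; y \<in> hcarrier H\<rbrakk>
      \<Longrightarrow> hinner H (hscale H c x) y = c * hinner H x y"
    and inner_commute: "\<lbrakk>x \<in> hcarrier H; y \<in> hcarrier H\<rbrakk>
      \<Longrightarrow> hinner H x y = cnj (hinner H y x)"
    and inner_pos: "\<lbrakk>x \<in> hcarrier H; x \<noteq> 0\<rbrakk> \<Longrightarrow> 0 < Re (hinner H x x)"
    and complete: "\<lbrakk>\<And>n. s n \<in> hcarrier H;
      \<And>e. 0 < e \<Longrightarrow> \<exists>N. \<forall>m\<ge>N. \<forall>n\<ge>N. hnorm H (s m - s n) < e\<rbrakk>
      \<Longrightarrow> \<exists>l\<in>hcarrier H. (\<lambda>n::nat. hnorm H (s n - l)) \<longlonglongrightarrow> 0"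

definition hlinear :: "'v::ab_group_add hspace \<Rightarrow> 'w::ab_group_add hspace \<Rightarrow> ('v \<Rightarrow> 'w) \<Rightarrow> bool" where
  "hlinear H K T \<longleftrightarrow>
     (\<forall>x\<in>hcarrier H. T x \<in> hcarrier K) \<and>
     (\<forall>x\<in>hcarrier H. \<forall>y\<in>hcarrier H. T (x + y) = T x + T y) \<and>
     (\<forall>c. \<forall>x\<in>hcarrier H. T (hscale H c x) = hscale K c (T x))"

definition bounded_operator :: "'v::ab_group_add hspace \<Rightarrow> ('v \<Rightarrow> 'v) \<Rightarrow> bool" where
  "bounded_operator H T \<longleftrightarrow>
     hlinear H H T \<and> (\<exists>B. \<forall>x\<in>hcarrier H. hnorm H (T x) \<le> B * hnorm H x)"

definition isometric_embedding ::
    "'v::ab_group_add hspace \<Rightarrow> 'w::ab_group_add hspace \<Rightarrow> ('v \<Rightarrow> 'w) \<Rightarrow> bool" where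
  "isometric_embedding H K J \<longleftrightarrow>
     hlinear H K J \<and>
     (\<forall>x\<in>hcarrier H. \<forall>y\<in>hcarrier H. hinner K (J x) (J y) = hinner H x y)"

definition unitary_operator :: "'v::ab_group_add hspace \<Rightarrow> ('v \<Rightarrow> 'v) \<Rightarrow> bool" where
  "unitary_operator K U \<longleftrightarrow> isometric_embedding K K U \<and> U ` hcarrier K = hcarrier K"

definition orthogonal_projection ::
    "'v::ab_group_add hspace \<Rightarrow> 'v set \<Rightarrow> ('v \<Rightarrow> 'v) \<Rightarrow> bool" where
  "orthogonal_projection K M P \<longleftrightarrow>
     (\<forall>x\<in>hcarrier K. P x \<in> M \<and> (\<forall>m\<in>M. hinner K (x - P x) m = 0))"

text \<open>
  The inclusion of \<open>H\<close> into \<open>K\<close> is an isometric embedding \<open>J\<close>, under which \<open>H\<close> is identified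
  with the subspace \<open>J ` H\<close>; the latter is closed because \<open>H\<close> is complete.
\<close>

definition rho_dilation :: "'v::ab_group_add hspace \<Rightarrow> real \<Rightarrow> ('v \<Rightarrow> 'v) \<Rightarrow>
    'w::ab_group_add hspace \<Rightarrow> ('v \<Rightarrow> 'w) \<Rightarrow> ('w \<Rightarrow> 'w) \<Rightarrow> ('w \<Rightarrow> 'w) \<Rightarrow> bool" where
  "rho_dilation H \<rho> T K J U P \<longleftrightarrow>
     complex_hilbert_space K \<and> isometric_embedding H K J \<and> unitary_operator K U \<and>
     orthogonal_projection K (J ` hcarrier H) P \<and>
     (\<forall>h\<in>hcarrier H. \<forall>n\<ge>1.
        J ((T ^^ n) h) = hscale K (complex_of_real \<rho>) (P ((U ^^ n) (J h))))"

text \<open>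
  HOL cannot quantify existentially over types, so the dilation space has to live in a fixed
  type.  The choice \<open>int \<Rightarrow> 'v \<Rightarrow> complex\<close> is no restriction: by lemma \<open>rho_contractionI\<close> below,
  a dilation in a space over an arbitrary type yields one over this type.
\<close>

definition rho_contraction :: "'v::ab_group_add hspace \<Rightarrow> real \<Rightarrow> ('v \<Rightarrow> 'v) \<Rightarrow> bool" where
  "rho_contraction H \<rho> T \<longleftrightarrow>
     bounded_operator H T \<and>
     (\<exists>(K :: (int \<Rightarrow> 'v \<Rightarrow> complex) hspace) J U P. rho_dilation H \<rho> T K J U P)"

definition rho_numerical_radius :: "'v::ab_group_add hspace \<Rightarrow> real \<Rightarrow> ('v \<Rightarrow> 'v) \<Rightarrow> real" where
  "rho_numerical_radius H \<rho> T =
     Inf {u. 0 < u \<and> rho_contraction H \<rho> (\<lambda>x. hscale H (complex_of_real (1 / u)) (T x))}"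

definition rank_one :: "'v::ab_group_add hspace \<Rightarrow> 'v \<Rightarrow> 'v \<Rightarrow> 'v \<Rightarrow> 'v" where
  "rank_one H a b = (\<lambda>x. hscale H (hinner H x a) b)"


subsection \<open>Independence of the ambient type of the dilation space\<close>

context complex_hilbert_space
begin

lemma zero_mem: "0 \<in> hcarrier H"
  and add_mem: "x \<in> hcarrier H \<Longrightarrow> y \<in> hcarrier H \<Longrightarrow> x + y \<in> hcarrier H"
  and scale_mem: "x \<in> hcarrier H \<Longrightarrow> hscale H c x \<in> hcarrier H"
proof -
  interpret vector_space "hscale H" by (rule scale)
  show "0 \<in> hcarrier H"
    and "x \<in> hcarrier H \<Longrightarrow> y \<in> hcarrier H \<Longrightarrow> x + y \<in> hcarrier H"
    and "x \<in> hcarrier H \<Longrightarrow> hscale H c x \<in> hcarrier H"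
    using subspace by (auto simp: subspace_def)
qed

lemma scale_minus_one: "hscale H (- 1) x = - x"
proof -
  interpret vector_space "hscale H" by (rule scale)
  show ?thesis by simp
qed

lemma minus_mem: "x \<in> hcarrier H \<Longrightarrow> - x \<in> hcarrier H"
  using scale_mem[of x "- 1"] by (simp add: scale_minus_one)

lemma diff_mem: "x \<in> hcarrier H \<Longrightarrow> y \<in> hcarrier H \<Longrightarrow> x - y \<in> hcarrier H"
  using add_mem[OF _ minus_mem, of x y] by simp

lemma inner_minus:
  "x \<in> hcarrier H \<Longrightarrow> z \<in> hcarrier H \<Longrightarrow> hinner H (- x) z = - hinner H x z"
  using inner_scale[of x z "- 1"] by (simp add: scale_minus_one)

lemma inner_diff:
  "\<lbrakk>x \<in> hcarrier H; y \<in> hcarrier H; z \<in> hcarrier H\<rbrakk>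
    \<Longrightarrow> hinner H (x - y) z = hinner H x z - hinner H y z"
  using inner_add[OF _ minus_mem, of x y z] by (simp add: inner_minus)

lemma inner_zero: "x \<in> hcarrier H \<Longrightarrow> hinner H 0 x = 0"
  using inner_diff[of x x x] by simp

lemma inner_self_zero: "x \<in> hcarrier H \<Longrightarrow> hinner H x x = 0 \<Longrightarrow> x = 0"
  using inner_pos by force

lemma inner_self: "x \<in> hcarrier H \<Longrightarrow> hinner H x x = of_real ((hnorm H x)\<^sup>2)"
proof -
  assume x: "x \<in> hcarrier H"
  have "Im (hinner H x x) = 0"
    using arg_cong[OF inner_commute[OF x x], of Im] by simp
  moreover have "0 \<le> Re (hinner H x x)"
    using inner_pos[OF x] inner_zero[OF x] by (cases "x = 0") auto
  ultimately show ?thesis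
    by (simp add: hnorm_def complex_eq_iff)
qed

lemma hnorm_nonneg: "x \<in> hcarrier H \<Longrightarrow> 0 \<le> hnorm H x"
  using inner_pos[of x] inner_zero[of x] by (cases "x = 0") (auto simp: hnorm_def)

lemma cauchy_schwarz:
  assumes x: "x \<in> hcarrier H" and y: "y \<in> hcarrier H"
  shows "cmod (hinner H x y) \<le> hnorm H x * hnorm H y"
proof (cases "y = 0")
  case True
  then show ?thesis using inner_commute[OF x y] inner_zero[OF x] inner_zero[OF y]
    by (simp add: hnorm_def)
next
  case False
  define p where "p = hinner H x y"
  define q where "q = (hnorm H y)\<^sup>2"
  have q: "q > 0"
    using inner_pos[OF y False] inner_self[OF y] by (simp add: q_def)
  define z where "z = x - hscale H (p / of_real q) y"
  have sy: "hscale H (p / of_real q) y \<in> hcarrier H" using y by (rule scale_mem)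
  have z: "z \<in> hcarrier H" unfolding z_def using x sy by (rule diff_mem)
  have zy: "hinner H z y = 0"
    using q by (simp add: z_def inner_diff[OF x sy y] inner_scale[OF y y] inner_self[OF y]
        flip: p_def q_def)
  have "hinner H z z = hinner H x z - (p / of_real q) * hinner H y z"
    using inner_diff[OF x sy z] inner_scale[OF y z] by (simp flip: z_def)
  also have "hinner H y z = 0" using inner_commute[OF y z] zy by simp
  also have "hinner H x z = cnj (hinner H x x - (p / of_real q) * hinner H y x)"
    by (subst inner_commute[OF x z]) (simp add: z_def inner_diff[OF x sy x] inner_scale[OF y x])
  also have "hinner H y x = cnj p" unfolding p_def by (rule inner_commute[OF y x])
  finally have "of_real ((hnorm H z)\<^sup>2) = cnj (of_real ((hnorm H x)\<^sup>2) - p * cnj p / of_real q)"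
    by (simp add: inner_self[OF z] inner_self[OF x])
  also have "\<dots> = of_real ((hnorm H x)\<^sup>2 - (cmod p)\<^sup>2 / q)"
    unfolding complex_norm_square[of p, symmetric] by simp
  finally have "(hnorm H z)\<^sup>2 = (hnorm H x)\<^sup>2 - (cmod p)\<^sup>2 / q"
    by (simp only: of_real_eq_iff)
  then have "(hnorm H x)\<^sup>2 - (cmod p)\<^sup>2 / q \<ge> 0"
    by (metis zero_le_power2)
  then have "(cmod p)\<^sup>2 \<le> (hnorm H x)\<^sup>2 * q"
    using q by (simp add: field_simps)
  then have "(cmod p)\<^sup>2 \<le> (hnorm H x * hnorm H y)\<^sup>2"
    by (simp add: q_def power_mult_distrib)
  moreover have "0 \<le> hnorm H x * hnorm H y"
    using hnorm_nonneg[OF x] hnorm_nonneg[OF y] by simp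
  ultimately show ?thesis unfolding p_def by (rule power2_le_imp_le)
qed

end

lemma rho_dilation_transfer:
  fixes \<phi> :: "'k::ab_group_add \<Rightarrow> 'l::ab_group_add"
  assumes dil: "rho_dilation H \<rho> T K J U P"
    and s: "vector_space s"
    and MK: "M \<subseteq> hcarrier K"
    and M0: "0 \<in> M"
    and Madd: "\<And>x y. x \<in> M \<Longrightarrow> y \<in> M \<Longrightarrow> x + y \<in> M"
    and Mscale: "\<And>c x. x \<in> M \<Longrightarrow> hscale K c x \<in> M"
    and Mlim: "\<And>\<sigma> l. \<lbrakk>\<And>n. \<sigma> n \<in> M; l \<in> hcarrier K; (\<lambda>n::nat. hnorm K (\<sigma> n - l)) \<longlonglongrightarrow> 0\<rbrakk> \<Longrightarrow> l \<in> M"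
    and UM: "U ` M = M"
    and JM: "J ` hcarrier H \<subseteq> M"
    and inj: "inj_on \<phi> M"
    and \<phi>add: "\<And>x y. x \<in> M \<Longrightarrow> y \<in> M \<Longrightarrow> \<phi> (x + y) = \<phi> x + \<phi> y"
    and \<phi>scale: "\<And>c x. x \<in> M \<Longrightarrow> \<phi> (hscale K c x) = s c (\<phi> x)"
  defines "\<psi> \<equiv> inv_into M \<phi>"
  shows "rho_dilation H \<rho> T
    \<lparr>hcarrier = \<phi> ` M, hscale = s, hinner = \<lambda>f g. hinner K (\<psi> f) (\<psi> g)\<rparr>
    (\<phi> \<circ> J) (\<phi> \<circ> U \<circ> \<psi>) (\<phi> \<circ> P \<circ> \<psi>)"
proof -
  let ?L = "\<lparr>hcarrier = \<phi> ` M, hscale = s, hinner = \<lambda>f g. hinner K (\<psi> f) (\<psi> g)\<rparr>"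
  from dil have K: "complex_hilbert_space K" and J: "isometric_embedding H K J"
    and U: "unitary_operator K U" and P: "orthogonal_projection K (J ` hcarrier H) P"
    and eq: "\<And>h n. h \<in> hcarrier H \<Longrightarrow> n \<ge> 1 \<Longrightarrow>
        J ((T ^^ n) h) = hscale K (complex_of_real \<rho>) (P ((U ^^ n) (J h)))"
    by (auto simp: rho_dilation_def)
  interpret K: complex_hilbert_space K by (rule K)
  interpret s: vector_space s by (rule s)
  have \<psi>\<phi>: "\<psi> (\<phi> x) = x" if "x \<in> M" for x
    using inj that by (simp add: \<psi>_def)
  have Mneg: "- x \<in> M" if "x \<in> M" for x
    using Mscale[OF that, of "- 1"] by (simp add: K.scale_minus_one)
  have Mdiff: "x - y \<in> M" if "x \<in> M" "y \<in> M" for x y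
    using Madd[OF that(1) Mneg[OF that(2)]] by simp
  have \<phi>diff: "\<phi> (x - y) = \<phi> x - \<phi> y" if "x \<in> M" "y \<in> M" for x y
    using \<phi>add[OF Mdiff[OF that] that(2)] by simp
  have \<phi>0: "\<phi> 0 = 0" using \<phi>diff[OF M0 M0] by simp
  have normL: "hnorm ?L (\<phi> x) = hnorm K x" if "x \<in> M" for x
    using that by (simp add: hnorm_def \<psi>\<phi>)
  have L: "complex_hilbert_space ?L"
  proof (rule complex_hilbert_space.intro, unfold hspace.simps, goal_cases)
    case 1 then show ?case by (rule s)
  next
    case 2 show ?case
      unfolding s.subspace_def
    proof (intro conjI ballI allI)
      show "0 \<in> \<phi> ` M" using M0 \<phi>0 by force
      fix f g c assume "f \<in> \<phi> ` M" "g \<in> \<phi> ` M"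
      then show "f + g \<in> \<phi> ` M" by (force simp flip: \<phi>add intro: Madd)
    next
      fix c f assume "f \<in> \<phi> ` M"
      then show "s c f \<in> \<phi> ` M" by (force simp flip: \<phi>scale intro: Mscale)
    qed
  next
    case (3 x y z) then show ?case
      using MK by (force simp: \<psi>\<phi> Madd K.inner_add subset_iff simp flip: \<phi>add)
  next
    case (4 x y c) then show ?case
      using MK by (force simp: \<psi>\<phi> Mscale K.inner_scale subset_iff simp flip: \<phi>scale)
  next
    case (5 x y) then show ?case
      using MK by (auto simp: \<psi>\<phi> intro!: K.inner_commute)
  next
    case (6 x) then show ?case
      using MK \<phi>0 by (auto simp: \<psi>\<phi> intro!: K.inner_pos)
  next
    case (7 \<sigma>)
    define t where "t = \<psi> \<circ> \<sigma>"
    have t: "t n \<in> M" and \<sigma>: "\<sigma> n = \<phi> (t n)" for n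
      using 7(1)[of n] by (auto simp: t_def \<psi>\<phi>)
    have n: "hnorm ?L (\<sigma> m - \<sigma> n) = hnorm K (t m - t n)" for m n
      by (simp add: \<sigma> t normL Mdiff flip: \<phi>diff)
    have "\<exists>l\<in>hcarrier K. (\<lambda>n. hnorm K (t n - l)) \<longlonglongrightarrow> 0"
      using 7(2) t MK by (intro K.complete) (auto simp: n)
    then obtain l where l: "l \<in> hcarrier K" "(\<lambda>n. hnorm K (t n - l)) \<longlonglongrightarrow> 0" by blast
    then have lM: "l \<in> M" using Mlim[of t l] t by blast
    have "hnorm ?L (\<sigma> n - \<phi> l) = hnorm K (t n - l)" for n
      by (simp add: \<sigma> t lM normL Mdiff flip: \<phi>diff)
    with l lM show ?case by (intro bexI[of _ "\<phi> l"]) auto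
  qed
  have Jm: "J h \<in> M" if "h \<in> hcarrier H" for h using JM that by auto
  have Um: "U x \<in> M" if "x \<in> M" for x using UM that by auto
  have Pm: "P x \<in> M" if "x \<in> M" for x
    using P JM MK that by (auto simp: orthogonal_projection_def)
  have JL: "isometric_embedding H ?L (\<phi> \<circ> J)"
    using J Jm by (auto simp: isometric_embedding_def hlinear_def \<psi>\<phi> \<phi>add \<phi>scale)
  have UL: "unitary_operator ?L (\<phi> \<circ> U \<circ> \<psi>)"
    unfolding unitary_operator_def
  proof
    have U1: "U (x + y) = U x + U y" "U (hscale K c x) = hscale K c (U x)"
      "hinner K (U x) (U y) = hinner K x y" if "x \<in> M" "y \<in> M" for x y c
      using U MK that by (auto simp: unitary_operator_def isometric_embedding_def hlinear_def subset_iff)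
    show "isometric_embedding ?L ?L (\<phi> \<circ> U \<circ> \<psi>)"
      unfolding isometric_embedding_def hlinear_def hspace.simps
      by (auto simp: \<psi>\<phi> Um U1 \<phi>add[symmetric] \<phi>scale[symmetric] Madd Mscale)
    have "(\<phi> \<circ> U \<circ> \<psi>) ` \<phi> ` M = \<phi> ` U ` M"
      unfolding image_image by (rule image_cong) (auto simp: \<psi>\<phi>)
    then show "(\<phi> \<circ> U \<circ> \<psi>) ` hcarrier ?L = hcarrier ?L" by (simp add: UM)
  qed
  have PL: "orthogonal_projection ?L ((\<phi> \<circ> J) ` hcarrier H) (\<phi> \<circ> P \<circ> \<psi>)"
    unfolding orthogonal_projection_def hspace.simps
  proof (intro ballI conjI)
    fix f assume "f \<in> \<phi> ` M"
    then obtain x where x: "x \<in> M" "f = \<phi> x" by auto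
    with P MK have Px: "P x \<in> J ` hcarrier H"
      "\<And>m. m \<in> J ` hcarrier H \<Longrightarrow> hinner K (x - P x) m = 0"
      by (auto simp: orthogonal_projection_def)
    show "(\<phi> \<circ> P \<circ> \<psi>) f \<in> (\<phi> \<circ> J) ` hcarrier H"
      using Px(1) x by (auto simp: \<psi>\<phi>)
    fix m assume "m \<in> (\<phi> \<circ> J) ` hcarrier H"
    then obtain h where h: "h \<in> hcarrier H" "m = \<phi> (J h)" by auto
    show "hinner K (\<psi> (f - (\<phi> \<circ> P \<circ> \<psi>) f)) (\<psi> m) = 0"
      using Px(2) h x by (simp add: \<psi>\<phi> Jm Pm Mdiff flip: \<phi>diff)
  qed
  have "((\<phi> \<circ> U \<circ> \<psi>) ^^ n) (\<phi> x) = \<phi> ((U ^^ n) x) \<and> (U ^^ n) x \<in> M" if "x \<in> M" for n x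
    using that by (induction n) (auto simp: \<psi>\<phi> Um)
  then have "(\<phi> \<circ> J) ((T ^^ n) h) =
      hscale ?L (complex_of_real \<rho>) ((\<phi> \<circ> P \<circ> \<psi>) (((\<phi> \<circ> U \<circ> \<psi>) ^^ n) ((\<phi> \<circ> J) h)))"
    if "h \<in> hcarrier H" "n \<ge> 1" for h n
    using eq[OF that] Jm[OF that(1)] by (simp add: \<psi>\<phi> \<phi>scale Pm)
  with L JL UL PL show ?thesis by (auto simp: rho_dilation_def)
qed

lemma rho_contractionI:
  fixes H :: "'v::ab_group_add hspace" and K :: "'k::ab_group_add hspace"
  assumes T: "bounded_operator H T" and dil: "rho_dilation H \<rho> T K J U P"
  shows "rho_contraction H \<rho> T"
proof -
  from dil have K: "complex_hilbert_space K" and J: "isometric_embedding H K J"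
    and U: "unitary_operator K U"
    by (auto simp: rho_dilation_def)
  interpret K: complex_hilbert_space K by (rule K)
  have Uc: "U x \<in> hcarrier K" and Ui: "y \<in> hcarrier K \<Longrightarrow> hinner K (U x) (U y) = hinner K x y"
    if "x \<in> hcarrier K" for x y
    using U that by (auto simp: unitary_operator_def isometric_embedding_def hlinear_def)
  define V where "V = inv_into (hcarrier K) U"
  have Vc: "V x \<in> hcarrier K" and UV: "U (V x) = x" if "x \<in> hcarrier K" for x
    using U that unfolding V_def unitary_operator_def
    by (metis inv_into_into, metis f_inv_into_f)
  have Ujd: "U (x - y) = U x - U y" if "x \<in> hcarrier K" "y \<in> hcarrier K" for x y
  proof -
    have "U (x - y + y) = U (x - y) + U y"
      using U K.diff_mem[OF that] that
      unfolding unitary_operator_def isometric_embedding_def hlinear_def by blast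
    then show ?thesis by simp
  qed
  have VU: "V (U x) = x" if x: "x \<in> hcarrier K" for x
  proof -
    have d: "V (U x) - x \<in> hcarrier K" by (intro K.diff_mem Vc Uc x)
    have "U (V (U x) - x) = 0" by (simp add: Ujd Vc Uc UV x)
    then have "hinner K (V (U x) - x) (V (U x) - x) = 0"
      using Ui[OF d d] K.inner_zero[OF K.zero_mem] by simp
    then show ?thesis using K.inner_self_zero[OF d] by simp
  qed
  have adj: "hinner K (U x) y = hinner K x (V y)" if "x \<in> hcarrier K" "y \<in> hcarrier K" for x y
    using Ui[of x "V y"] that by (simp add: Vc UV)
  have adj': "hinner K (V x) y = hinner K x (U y)" if "x \<in> hcarrier K" "y \<in> hcarrier K" for x y
    using Ui[of "V x" y] that by (simp add: Vc UV)
  define W where "W n = (if 0 \<le> n then U ^^ nat n else V ^^ nat (- n))" for n :: int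
  have Wc: "W n x \<in> hcarrier K" if "x \<in> hcarrier K" for n x
  proof -
    have "(U ^^ m) x \<in> hcarrier K \<and> (V ^^ m) x \<in> hcarrier K" for m
      using that by (induction m) (auto simp: Uc Vc)
    then show ?thesis by (simp add: W_def)
  qed
  have UW: "U (W n x) = W (n + 1) x" if "x \<in> hcarrier K" for n x
  proof (cases "0 \<le> n")
    case True
    then show ?thesis by (simp add: W_def nat_add_distrib)
  next
    case False
    have c: "(V ^^ m) x \<in> hcarrier K" for m
      using that by (induction m) (auto simp: Vc)
    from False obtain m where m: "n = - int (Suc m)"
      by (metis int_cases of_nat_0_le_iff)
    have "nat (- n) = Suc m" "nat (- (n + 1)) = m" using m by auto
    then have "W n x = V ((V ^^ m) x)" using False by (simp add: W_def)
    moreover have "W (n + 1) x = (V ^^ m) x"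
    proof (cases "m = 0")
      case True
      then show ?thesis by (simp add: W_def m)
    next
      case False
      then have "\<not> 0 \<le> n + 1" using m by simp
      then show ?thesis unfolding W_def by (simp only: if_False \<open>nat (- (n + 1)) = m\<close>)
    qed
    ultimately show ?thesis by (simp add: UV c)
  qed
  have VW: "V (W n x) = W (n - 1) x" if "x \<in> hcarrier K" for n x
    using VU[OF Wc[OF that]] UW[OF that, of "n - 1"] by (metis diff_add_cancel)
  have Jc: "J h \<in> hcarrier K" if "h \<in> hcarrier H" for h
    using J that by (auto simp: isometric_embedding_def hlinear_def)
  define N where
    "N = {y \<in> hcarrier K. \<forall>n. \<forall>h\<in>hcarrier H. hinner K y (W n (J h)) = 0}"
  define M where "M = {x \<in> hcarrier K. \<forall>y\<in>N. hinner K x y = 0}"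
  define \<phi> where
    "\<phi> x = (\<lambda>n h. if h \<in> hcarrier H then hinner K x (W n (J h)) else 0)" for x
  have NU: "U y \<in> N" and NV: "V y \<in> N" if "y \<in> N" for y
    using that by (auto simp: N_def Uc Vc adj adj' Wc Jc UW VW)
  have MK: "M \<subseteq> hcarrier K" by (auto simp: M_def)
  have NK: "N \<subseteq> hcarrier K" by (auto simp: N_def)
  define s where "s c f = (\<lambda>(n::int) (h::'v). c * f n h)" for c :: complex and f
  have "vector_space s"
    by unfold_locales (auto simp: s_def algebra_simps fun_eq_iff)
  moreover have "0 \<in> M" using NK by (auto simp: M_def K.zero_mem K.inner_zero)
  moreover have "x + y \<in> M" if "x \<in> M" "y \<in> M" for x y
    using that NK by (auto simp: M_def K.add_mem K.inner_add subset_iff)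
  moreover have "hscale K c x \<in> M" if "x \<in> M" for c x
    using that NK by (auto simp: M_def K.scale_mem K.inner_scale subset_iff)
  moreover have "l \<in> M" if \<sigma>: "\<And>n. \<sigma> n \<in> M" and l: "l \<in> hcarrier K"
    and lim: "(\<lambda>n::nat. hnorm K (\<sigma> n - l)) \<longlonglongrightarrow> 0" for \<sigma> l
  proof -
    have "hinner K l y = 0" if y: "y \<in> N" for y
    proof -
      have yc: "y \<in> hcarrier K" using y NK by auto
      have "cmod (hinner K l y) \<le> hnorm K (\<sigma> n - l) * hnorm K y" for n
      proof -
        have \<sigma>c: "\<sigma> n \<in> hcarrier K" and 0: "hinner K (\<sigma> n) y = 0"
          using \<sigma>[of n] y by (auto simp: M_def)
        show ?thesis
          using K.cauchy_schwarz[OF K.diff_mem[OF \<sigma>c l] yc] 0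
          by (simp add: K.inner_diff[OF \<sigma>c l yc])
      qed
      moreover have "(\<lambda>n. hnorm K (\<sigma> n - l) * hnorm K y) \<longlonglongrightarrow> 0"
        using tendsto_mult_right[OF lim, of "hnorm K y"] by simp
      ultimately have "cmod (hinner K l y) \<le> 0"
        by (intro LIMSEQ_le_const) auto
      then show ?thesis by simp
    qed
    then show ?thesis using l by (auto simp: M_def)
  qed
  moreover have "U ` M = M"
  proof
    show "U ` M \<subseteq> M" using NK NV by (auto simp: M_def Uc adj subset_iff)
    show "M \<subseteq> U ` M"
    proof
      fix x assume x: "x \<in> M"
      then have "V x \<in> M" using NK NU by (auto simp: M_def Vc adj' subset_iff)
      then show "x \<in> U ` M" using UV[of x] x MK by (metis image_eqI subsetD)
    qed
  qed
  moreover have "J ` hcarrier H \<subseteq> M"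
  proof clarify
    fix h assume h: "h \<in> hcarrier H"
    have "hinner K (J h) y = 0" if "y \<in> N" for y
    proof -
      have "hinner K y (W 0 (J h)) = 0" using that h by (auto simp: N_def)
      then show ?thesis
        using K.inner_commute[of "J h" y] that NK h by (auto simp: W_def Jc)
    qed
    then show "J h \<in> M" using h by (auto simp: M_def Jc)
  qed
  moreover have "inj_on \<phi> M"
  proof
    fix x y assume x: "x \<in> M" and y: "y \<in> M" and e: "\<phi> x = \<phi> y"
    have c: "x \<in> hcarrier K" "y \<in> hcarrier K" using x y MK by auto
    have d: "x - y \<in> hcarrier K" using c by (rule K.diff_mem)
    have "hinner K x (W n (J h)) = hinner K y (W n (J h))" if "h \<in> hcarrier H" for n h
      using fun_cong[OF fun_cong[OF e], of n h] that by (simp add: \<phi>_def)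
    then have N: "x - y \<in> N" using d c by (auto simp: N_def K.inner_diff Wc Jc)
    then have "hinner K (x - y) (x - y) = 0"
      using x y by (subst K.inner_diff[OF c d]) (auto simp: M_def)
    then show "x = y" using K.inner_self_zero[OF d] by simp
  qed
  moreover have "\<phi> (x + y) = \<phi> x + \<phi> y" if "x \<in> M" "y \<in> M" for x y
    using that MK by (auto simp: \<phi>_def fun_eq_iff K.inner_add Wc Jc subset_iff)
  moreover have "\<phi> (hscale K c x) = s c (\<phi> x)" if "x \<in> M" for c x
    using that MK by (auto simp: \<phi>_def s_def fun_eq_iff K.inner_scale Wc Jc subset_iff)
  ultimately have "rho_dilation H \<rho> T
      \<lparr>hcarrier = \<phi> ` M, hscale = s,
        hinner = \<lambda>f g. hinner K (inv_into M \<phi> f) (inv_into M \<phi> g)\<rparr>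
      (\<phi> \<circ> J) (\<phi> \<circ> U \<circ> inv_into M \<phi>) (\<phi> \<circ> P \<circ> inv_into M \<phi>)"
    by (rule rho_dilation_transfer[OF dil _ MK])
  with T show ?thesis
    unfolding rho_contraction_def by (intro conjI exI)
qed

end

theory Submission
  imports Defs "HOL-Analysis.Infinite_Sum"
begin

text \<open>
  Write \<open>T\<close> for the operator \<open>x \<mapsto> \<langle>x,a\<rangle> b\<close> and \<open>c = \<langle>b,a\<rangle>\<close>.  Replacing \<open>b\<close> by \<open>b / u\<close> shows that the formula says
  when \<open>T\<close> is a \<open>\<rho>\<close>-contraction: this forces \<open>\<parallel>a\<parallel> \<parallel>b\<parallel> + \<bar>1 - \<rho>\<bar> \<bar>c\<bar> \<le> \<rho>\<close>
  (\<open>rho_contraction_rank_one_bound\<close>), and the strict inequality suffices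
  (\<open>rank_one_rho_contraction\<close>).  Both halves use that a dilation only has to reproduce the
  moments \<open>\<langle>T\<^sup>n h, g\<rangle> = \<rho> \<langle>U\<^sup>n J h, J g\<rangle>\<close> for \<open>n \<ge> 1\<close>, and that the powers of \<open>T\<close> are geometric:
  \<open>T\<^sup>n\<^sup>+\<^sup>1 = c\<^sup>n T\<close>.

  For necessity, unitarity of \<open>U\<close> makes the real part of \<open>(I + z U) (I - z U)\<^sup>-\<^sup>1\<close> positive for
  \<open>\<bar>z\<bar> < 1\<close>.  On the vectors \<open>J h\<close> this reads
  \<open>\<parallel>h\<parallel>\<^sup>2 + (2 / \<rho>) Re (w \<langle>h,a\<rangle> \<langle>b,h\<rangle>) \<ge> 0\<close> with \<open>w = z / (1 - c z)\<close>
  (\<open>unitary_moments_positive\<close>).  The vector \<open>h = \<parallel>w b\<parallel> a - \<parallel>a\<parallel> w b\<close>, with \<open>z\<close> close to the unit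
  circle and \<open>c z\<close> real with the sign of \<open>\<rho> - 1\<close>, yields the inequality.

  For sufficiency, feed vectors \<open>h\<^sub>n\<close> into the scalar recurrence \<open>s\<^sub>n\<^sub>+\<^sub>1 = c s\<^sub>n + \<langle>h\<^sub>n,a\<rangle>\<close>.  The
  quadratic form whose positivity is needed is the sum over \<open>n\<close> of
  \<open>\<parallel>h\<^sub>n\<parallel>\<^sup>2 + (2 / \<rho>) Re (s\<^sub>n \<langle>b,h\<^sub>n\<rangle>)\<close>.  Subtracting the telescoping term
  \<open>X (\<bar>s\<^sub>n\<^sub>+\<^sub>1\<bar>\<^sup>2 - \<bar>s\<^sub>n\<bar>\<^sup>2)\<close> turns each summand into a perfect square \<open>\<parallel>R h\<^sub>n + s\<^sub>n e\<parallel>\<^sup>2\<close>, provided that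
  \<open>X\<close> is a root of a quadratic equation; the assumed inequality is what makes the root real
  (\<open>smaller_root\<close>, \<open>factor_defect\<close>).  The response of this system to a single input \<open>h\<close> at time
  \<open>0\<close> is the sequence \<open>R h, \<langle>h,a\<rangle> e, c \<langle>h,a\<rangle> e, c\<^sup>2 \<langle>h,a\<rangle> e, \<dots>\<close>.  It is taken as \<open>J h\<close> in the
  space of square summable two-sided sequences in \<open>H\<close>, where the shift is the unitary dilation.
\<close>


section \<open>Geometry of a Hilbert space\<close>

context complex_hilbert_space
begin

lemma inner_add_right:
  "\<lbrakk>x \<in> hcarrier H; y \<in> hcarrier H; z \<in> hcarrier H\<rbrakk>
    \<Longrightarrow> hinner H x (y + z) = hinner H x y + hinner H x z"
  using inner_commute[of x "y + z"] inner_commute[of x y] inner_commute[of x z]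
  by (simp add: add_mem inner_add)

lemma inner_scale_right:
  "\<lbrakk>x \<in> hcarrier H; y \<in> hcarrier H\<rbrakk> \<Longrightarrow> hinner H x (hscale H c y) = cnj c * hinner H x y"
  using inner_commute[of x "hscale H c y"] inner_commute[of x y]
  by (simp add: scale_mem inner_scale)

lemma inner_diff_right:
  "\<lbrakk>x \<in> hcarrier H; y \<in> hcarrier H; z \<in> hcarrier H\<rbrakk>
    \<Longrightarrow> hinner H x (y - z) = hinner H x y - hinner H x z"
  using inner_commute[of x "y - z"] inner_commute[of x y] inner_commute[of x z]
  by (simp add: diff_mem inner_diff)

lemma inner_zero_right: "x \<in> hcarrier H \<Longrightarrow> hinner H x 0 = 0"
  using inner_commute[OF _ zero_mem, of x] by (simp add: inner_zero)

lemma scale_simps: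
  "hscale H c (hscale H d x) = hscale H (c * d) x"
  "hscale H (c + d) x = hscale H c x + hscale H d x"
  "hscale H c (x + y) = hscale H c x + hscale H c y"
  "hscale H c (x - y) = hscale H c x - hscale H c y"
  "hscale H 1 x = x" "hscale H 0 x = 0" "hscale H c 0 = 0"
proof -
  interpret vector_space "hscale H" by (rule scale)
  show "hscale H c (hscale H d x) = hscale H (c * d) x"
    "hscale H (c + d) x = hscale H c x + hscale H d x"
    "hscale H c (x + y) = hscale H c x + hscale H c y"
    "hscale H c (x - y) = hscale H c x - hscale H c y"
    "hscale H 1 x = x" "hscale H 0 x = 0" "hscale H c 0 = 0"
    by (simp_all add: scale_left_distrib scale_right_distrib scale_right_diff_distrib)
qed

lemma hnorm_sq: "x \<in> hcarrier H \<Longrightarrow> (hnorm H x)\<^sup>2 = Re (hinner H x x)"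
  by (simp add: inner_self)

lemma hnorm_zero: "hnorm H 0 = 0"
  by (simp add: hnorm_def inner_zero zero_mem)

lemma hnorm_eq_zero: "x \<in> hcarrier H \<Longrightarrow> hnorm H x = 0 \<Longrightarrow> x = 0"
  using inner_self_zero[of x] inner_self[of x] by simp

lemma eq_if_inner_eq:
  assumes "x \<in> hcarrier H" "y \<in> hcarrier H"
    and "\<And>z. z \<in> hcarrier H \<Longrightarrow> hinner H x z = hinner H y z"
  shows "x = y"
proof -
  have "hinner H (x - y) (x - y) = 0"
    using assms by (simp add: inner_diff diff_mem)
  then show ?thesis using inner_self_zero[OF diff_mem] assms by force
qed

lemma hnorm_scale: "x \<in> hcarrier H \<Longrightarrow> hnorm H (hscale H c x) = cmod c * hnorm H x"
proof -
  assume x: "x \<in> hcarrier H"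
  have "hinner H (hscale H c x) (hscale H c x) = c * cnj c * hinner H x x"
    using x by (simp add: scale_mem inner_scale inner_scale_right)
  then have "(hnorm H (hscale H c x))\<^sup>2 = Re (c * cnj c * hinner H x x)"
    using x by (simp only: hnorm_sq scale_mem)
  also have "\<dots> = (cmod c * hnorm H x)\<^sup>2"
    by (simp add: inner_self[OF x] complex_norm_square[symmetric] power_mult_distrib
        flip: of_real_mult of_real_power)
  finally show ?thesis
    using x by (simp add: hnorm_nonneg scale_mem)
qed

lemma hnorm_minus: "x \<in> hcarrier H \<Longrightarrow> hnorm H (- x) = hnorm H x"
  using hnorm_scale[of x "- 1"] by (simp add: scale_minus_one)

lemma hnorm_minus_commute:
  "\<lbrakk>x \<in> hcarrier H; y \<in> hcarrier H\<rbrakk> \<Longrightarrow> hnorm H (x - y) = hnorm H (y - x)"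
  using hnorm_minus[OF diff_mem, of x y] by simp

lemma hnorm_add_sq:
  assumes "x \<in> hcarrier H" "y \<in> hcarrier H"
  shows "(hnorm H (x + y))\<^sup>2 = (hnorm H x)\<^sup>2 + (hnorm H y)\<^sup>2 + 2 * Re (hinner H x y)"
  using assms inner_commute[of y x]
  by (simp add: hnorm_sq add_mem inner_add inner_add_right)

lemma hnorm_diff_sq:
  assumes "x \<in> hcarrier H" "y \<in> hcarrier H"
  shows "(hnorm H (x - y))\<^sup>2 = (hnorm H x)\<^sup>2 + (hnorm H y)\<^sup>2 - 2 * Re (hinner H x y)"
  using assms inner_commute[of y x]
  by (simp add: hnorm_sq diff_mem inner_diff inner_diff_right)

lemma hnorm_triangle:
  assumes "x \<in> hcarrier H" "y \<in> hcarrier H"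
  shows "hnorm H (x + y) \<le> hnorm H x + hnorm H y"
proof (rule power2_le_imp_le)
  have "Re (hinner H x y) \<le> hnorm H x * hnorm H y"
    using cauchy_schwarz[OF assms] complex_Re_le_cmod[of "hinner H x y"] by linarith
  then show "(hnorm H (x + y))\<^sup>2 \<le> (hnorm H x + hnorm H y)\<^sup>2"
    by (simp add: hnorm_add_sq[OF assms] power2_sum)
qed (use assms hnorm_nonneg in auto)

lemma hnorm_add_sq_le:
  assumes "x \<in> hcarrier H" "y \<in> hcarrier H"
  shows "(hnorm H (x + y))\<^sup>2 \<le> 2 * (hnorm H x)\<^sup>2 + 2 * (hnorm H y)\<^sup>2"
proof -
  have "(hnorm H (x + y))\<^sup>2 \<le> (hnorm H x + hnorm H y)\<^sup>2"
    using hnorm_triangle[OF assms] hnorm_nonneg add_mem assms by (intro power_mono) auto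
  also have "\<dots> \<le> 2 * (hnorm H x)\<^sup>2 + 2 * (hnorm H y)\<^sup>2"
    using sum_squares_bound[of "hnorm H x" "hnorm H y"] by (simp add: power2_sum)
  finally show ?thesis .
qed

lemma hnorm_diff_tendsto:
  assumes x: "x \<in> hcarrier H" and y: "\<And>k. y k \<in> hcarrier H" and l: "l \<in> hcarrier H"
    and lim: "(\<lambda>k::nat. hnorm H (y k - l)) \<longlonglongrightarrow> 0"
  shows "(\<lambda>k. hnorm H (x - y k)) \<longlonglongrightarrow> hnorm H (x - l)"
proof -
  have "\<bar>hnorm H (x - y k) - hnorm H (x - l)\<bar> \<le> hnorm H (y k - l)" for k
    using hnorm_triangle[of "x - l" "l - y k"] hnorm_triangle[of "x - y k" "y k - l"]
      hnorm_minus_commute[of l "y k"]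
    by (simp add: diff_mem x y l)
  then have "(\<lambda>k. hnorm H (x - y k) - hnorm H (x - l)) \<longlonglongrightarrow> 0"
    by (intro tendsto_rabs_zero_cancel[OF tendsto_sandwich[OF _ _ tendsto_const lim]]) auto
  then show ?thesis by (simp add: LIM_zero_iff)
qed

end


section \<open>Square summable families of vectors\<close>

definition l2_space :: "'v::ab_group_add hspace \<Rightarrow> ('i \<Rightarrow> 'v) hspace" where
  "l2_space H = \<lparr>
     hcarrier = {f. (\<forall>n. f n \<in> hcarrier H) \<and> (\<lambda>n. (hnorm H (f n))\<^sup>2) summable_on UNIV},
     hscale = (\<lambda>c f n. hscale H c (f n)),
     hinner = (\<lambda>f g. \<Sum>\<^sub>\<infinity>n. hinner H (f n) (g n))\<rparr>"

context complex_hilbert_space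
begin

lemma l2_mem:
  "f \<in> hcarrier (l2_space H) \<longleftrightarrow>
    (\<forall>n. f n \<in> hcarrier H) \<and> (\<lambda>n. (hnorm H (f n))\<^sup>2) summable_on UNIV"
  by (simp add: l2_space_def)

lemma l2_coord: "f \<in> hcarrier (l2_space H) \<Longrightarrow> f n \<in> hcarrier H"
  by (simp add: l2_mem)

lemma l2_scale_apply: "hscale (l2_space H) c f n = hscale H c (f n)"
  by (simp add: l2_space_def)

lemma l2_inner: "hinner (l2_space H) f g = (\<Sum>\<^sub>\<infinity>n. hinner H (f n) (g n))"
  by (simp add: l2_space_def)

lemma l2_inner_summable:
  assumes f: "f \<in> hcarrier (l2_space H)" and g: "g \<in> hcarrier (l2_space H)"
  shows "(\<lambda>n. hinner H (f n) (g n)) summable_on UNIV"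
proof (rule abs_summable_summable)
  have "(\<lambda>n. (hnorm H (f n))\<^sup>2 + (hnorm H (g n))\<^sup>2) summable_on UNIV"
    using f g by (intro summable_on_add) (auto simp: l2_mem)
  then show "(\<lambda>n. hinner H (f n) (g n)) abs_summable_on UNIV"
  proof (rule abs_summable_on_comparison_test')
    fix n
    have "cmod (hinner H (f n) (g n)) \<le> hnorm H (f n) * hnorm H (g n)"
      by (rule cauchy_schwarz[OF l2_coord[OF f] l2_coord[OF g]])
    also have "\<dots> \<le> (hnorm H (f n))\<^sup>2 + (hnorm H (g n))\<^sup>2"
      using sum_squares_bound[of "hnorm H (f n)" "hnorm H (g n)"]
        mult_nonneg_nonneg[OF hnorm_nonneg[OF l2_coord[OF f, of n]]
          hnorm_nonneg[OF l2_coord[OF g, of n]]]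
      by linarith
    finally show "cmod (hinner H (f n) (g n)) \<le> (hnorm H (f n))\<^sup>2 + (hnorm H (g n))\<^sup>2" .
  qed
qed

lemma l2_add_mem:
  assumes f: "f \<in> hcarrier (l2_space H)" and g: "g \<in> hcarrier (l2_space H)"
  shows "f + g \<in> hcarrier (l2_space H)"
proof -
  have "(\<lambda>n. 2 * (hnorm H (f n))\<^sup>2 + 2 * (hnorm H (g n))\<^sup>2) summable_on UNIV"
    using f g by (intro summable_on_add summable_on_cmult_right) (auto simp: l2_mem)
  then have "(\<lambda>n. (hnorm H (f n + g n))\<^sup>2) summable_on UNIV"
    by (rule summable_on_comparison_test)
      (simp_all add: hnorm_add_sq_le l2_coord[OF f] l2_coord[OF g])
  then show ?thesis using f g by (simp add: l2_mem add_mem)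
qed

lemma l2_scale_mem:
  assumes f: "f \<in> hcarrier (l2_space H)"
  shows "hscale (l2_space H) c f \<in> hcarrier (l2_space H)"
proof -
  have "(\<lambda>n. (cmod c)\<^sup>2 * (hnorm H (f n))\<^sup>2) summable_on UNIV"
    using f by (intro summable_on_cmult_right) (auto simp: l2_mem)
  then show ?thesis
    using f by (simp add: l2_mem l2_scale_apply scale_mem hnorm_scale power_mult_distrib)
qed

lemma l2_zero_mem: "0 \<in> hcarrier (l2_space H)"
  by (simp add: l2_mem zero_mem hnorm_zero)

lemma l2_inner_self:
  assumes f: "f \<in> hcarrier (l2_space H)"
  shows "Re (hinner (l2_space H) f f) = (\<Sum>\<^sub>\<infinity>n. (hnorm H (f n))\<^sup>2)"
proof -
  have "Re (hinner (l2_space H) f f) = (\<Sum>\<^sub>\<infinity>n. Re (hinner H (f n) (f n)))"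
    unfolding l2_inner by (rule infsum_Re[OF l2_inner_summable[OF f f], symmetric])
  also have "\<dots> = (\<Sum>\<^sub>\<infinity>n. (hnorm H (f n))\<^sup>2)"
    by (intro infsum_cong) (simp add: hnorm_sq l2_coord[OF f])
  finally show ?thesis .
qed

lemma l2_hnorm_sq:
  assumes f: "f \<in> hcarrier (l2_space H)"
  shows "(hnorm (l2_space H) f)\<^sup>2 = (\<Sum>\<^sub>\<infinity>n. (hnorm H (f n))\<^sup>2)"
proof -
  have "0 \<le> (\<Sum>\<^sub>\<infinity>n. (hnorm H (f n))\<^sup>2)" by (intro infsum_nonneg) auto
  then show ?thesis unfolding hnorm_def l2_inner_self[OF f, unfolded hnorm_def] by simp
qed

lemma l2_hnorm_nonneg: "f \<in> hcarrier (l2_space H) \<Longrightarrow> 0 \<le> hnorm (l2_space H) f"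
  unfolding hnorm_def[of "l2_space H"] l2_inner_self by (simp add: infsum_nonneg)

lemma l2_finite_sum_le:
  assumes f: "f \<in> hcarrier (l2_space H)" and F: "finite F"
  shows "(\<Sum>n\<in>F. (hnorm H (f n))\<^sup>2) \<le> (hnorm (l2_space H) f)\<^sup>2"
  unfolding l2_hnorm_sq[OF f] using f F by (intro finite_sum_le_infsum) (auto simp: l2_mem)

lemma l2_coord_le:
  assumes f: "f \<in> hcarrier (l2_space H)"
  shows "hnorm H (f n) \<le> hnorm (l2_space H) f"
  using l2_finite_sum_le[OF f, of "{n}"] hnorm_nonneg[OF l2_coord[OF f]] l2_hnorm_nonneg[OF f]
  by (simp add: power2_le_iff_abs_le)

lemma l2_diff_mem:
  assumes f: "f \<in> hcarrier (l2_space H)" and g: "g \<in> hcarrier (l2_space H)"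
  shows "f - g \<in> hcarrier (l2_space H)"
proof -
  have "hscale (l2_space H) (- 1) g = - g"
    by (auto simp: l2_scale_apply scale_minus_one fun_eq_iff)
  then show ?thesis using l2_add_mem[OF f l2_scale_mem[OF g, of "- 1"]] by simp
qed

text \<open>
  The limit of a Cauchy sequence is taken coordinatewise; a bound for the finite partial sums
  of the squared distance survives this limit, which gives both membership of the limit and
  convergence in norm.
\<close>

lemma l2_complete:
  assumes s: "\<And>k. s k \<in> hcarrier (l2_space H)"
    and cauchy: "\<And>e. 0 < e \<Longrightarrow> \<exists>N. \<forall>m\<ge>N. \<forall>k\<ge>N. hnorm (l2_space H) (s m - s k) < e"
  shows "\<exists>l\<in>hcarrier (l2_space H). (\<lambda>k::nat. hnorm (l2_space H) (s k - l)) \<longlonglongrightarrow> 0"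
proof -
  have "\<exists>l\<in>hcarrier H. (\<lambda>k. hnorm H (s k n - l)) \<longlonglongrightarrow> 0" for n
  proof (rule complete)
    show "s k n \<in> hcarrier H" for k using s by (rule l2_coord)
    fix e :: real assume "0 < e"
    then obtain N where N: "\<And>m k. m \<ge> N \<Longrightarrow> k \<ge> N \<Longrightarrow> hnorm (l2_space H) (s m - s k) < e"
      using cauchy by blast
    have "hnorm H (s m n - s k n) < e" if "m \<ge> N" "k \<ge> N" for m k
      using l2_coord_le[OF l2_diff_mem[OF s s], of m k n] N[OF that] by simp
    then show "\<exists>N. \<forall>m\<ge>N. \<forall>k\<ge>N. hnorm H (s m n - s k n) < e" by blast
  qed
  then obtain l where lH: "\<And>n. l n \<in> hcarrier H"
    and l: "\<And>n. (\<lambda>k. hnorm H (s k n - l n)) \<longlonglongrightarrow> 0"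
    by metis
  have tail: "\<exists>N. \<forall>m\<ge>N. \<forall>F. finite F \<longrightarrow> (\<Sum>n\<in>F. (hnorm H (s m n - l n))\<^sup>2) \<le> e\<^sup>2"
    if e: "0 < e" for e
  proof -
    obtain N where N: "\<And>m k. m \<ge> N \<Longrightarrow> k \<ge> N \<Longrightarrow> hnorm (l2_space H) (s m - s k) < e"
      using cauchy[OF e] by blast
    have "(\<Sum>n\<in>F. (hnorm H (s m n - l n))\<^sup>2) \<le> e\<^sup>2" if m: "m \<ge> N" and F: "finite F" for m F
    proof (rule LIMSEQ_le_const2)
      show "(\<lambda>k. \<Sum>n\<in>F. (hnorm H (s m n - s k n))\<^sup>2) \<longlonglongrightarrow> (\<Sum>n\<in>F. (hnorm H (s m n - l n))\<^sup>2)"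
        by (intro tendsto_sum tendsto_power hnorm_diff_tendsto l2_coord[OF s] lH l)
      have "(\<Sum>n\<in>F. (hnorm H (s m n - s k n))\<^sup>2) \<le> e\<^sup>2" if "k \<ge> N" for k
      proof -
        have "(\<Sum>n\<in>F. (hnorm H (s m n - s k n))\<^sup>2) \<le> (hnorm (l2_space H) (s m - s k))\<^sup>2"
          using l2_finite_sum_le[OF l2_diff_mem[OF s s] F, of m k] by simp
        also have "\<dots> \<le> e\<^sup>2"
          using N[OF m that] l2_hnorm_nonneg[OF l2_diff_mem[OF s s], of m k]
          by (intro power_mono) auto
        finally show ?thesis .
      qed
      then show "\<exists>N. \<forall>k\<ge>N. (\<Sum>n\<in>F. (hnorm H (s m n - s k n))\<^sup>2) \<le> e\<^sup>2" by blast
    qed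
    then show ?thesis by blast
  qed
  have mem: "s m - l \<in> hcarrier (l2_space H)"
    if "\<And>F. finite F \<Longrightarrow> (\<Sum>n\<in>F. (hnorm H (s m n - l n))\<^sup>2) \<le> e" for m e
  proof -
    have "(\<lambda>n. (hnorm H (s m n - l n))\<^sup>2) summable_on UNIV"
      using that by (intro nonneg_bdd_above_summable_on bdd_aboveI2) auto
    then show ?thesis using lH l2_coord[OF s] by (simp add: l2_mem diff_mem)
  qed
  have close: "\<exists>N. \<forall>m\<ge>N. s m - l \<in> hcarrier (l2_space H) \<and> hnorm (l2_space H) (s m - l) \<le> e"
    if e: "0 < e" for e
  proof -
    obtain N where N: "\<And>m F. m \<ge> N \<Longrightarrow> finite F \<Longrightarrow> (\<Sum>n\<in>F. (hnorm H (s m n - l n))\<^sup>2) \<le> e\<^sup>2"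
      using tail[OF e] by blast
    have "s m - l \<in> hcarrier (l2_space H) \<and> hnorm (l2_space H) (s m - l) \<le> e" if m: "m \<ge> N" for m
    proof
      show 1: "s m - l \<in> hcarrier (l2_space H)" using N[OF m] by (rule mem)
      have "(hnorm (l2_space H) (s m - l))\<^sup>2 \<le> e\<^sup>2"
        unfolding l2_hnorm_sq[OF 1] using 1 N[OF m]
        by (intro infsum_le_finite_sums) (auto simp: l2_mem)
      then show "hnorm (l2_space H) (s m - l) \<le> e" using e by (simp add: power2_le_iff_abs_le)
    qed
    then show ?thesis by blast
  qed
  obtain N where "s N - l \<in> hcarrier (l2_space H)"
    using close[OF zero_less_one] by blast
  from l2_diff_mem[OF s[of N] this] have "l \<in> hcarrier (l2_space H)" by simp
  moreover have "(\<lambda>k. hnorm (l2_space H) (s k - l)) \<longlonglongrightarrow> 0"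
  proof (rule LIMSEQ_I)
    fix r :: real assume "0 < r"
    then obtain N where N: "\<And>m. m \<ge> N \<Longrightarrow> s m - l \<in> hcarrier (l2_space H)"
      "\<And>m. m \<ge> N \<Longrightarrow> hnorm (l2_space H) (s m - l) \<le> r / 2"
      using close[of "r / 2"] by auto
    have "\<bar>hnorm (l2_space H) (s m - l)\<bar> < r" if "m \<ge> N" for m
      using N[OF that] l2_hnorm_nonneg[OF N(1)[OF that]] \<open>0 < r\<close> by linarith
    then show "\<exists>N. \<forall>m\<ge>N. norm (hnorm (l2_space H) (s m - l) - 0) < r" by auto
  qed
  ultimately show ?thesis by blast
qed

lemma l2_hilbert: "complex_hilbert_space (l2_space H :: ('i \<Rightarrow> 'v) hspace)"
proof (rule complex_hilbert_space.intro, goal_cases)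
  case 1
  show ?case
    by unfold_locales (auto simp: l2_scale_apply scale_simps fun_eq_iff)
next
  case 2
  interpret l2: vector_space "hscale (l2_space H :: ('i \<Rightarrow> 'v) hspace)"
    by unfold_locales (auto simp: l2_scale_apply scale_simps fun_eq_iff)
  show ?case
    by (auto simp: l2.subspace_def l2_zero_mem l2_add_mem l2_scale_mem)
next
  case (3 f g h)
  then show ?case
    by (simp add: l2_inner inner_add l2_coord infsum_add l2_inner_summable)
next
  case (4 f g c)
  then show ?case
    by (simp add: l2_inner l2_scale_apply inner_scale l2_coord infsum_cmult_right')
next
  case (5 f g)
  have "hinner H (f n) (g n) = cnj (hinner H (g n) (f n))" for n
    by (rule inner_commute[OF l2_coord[OF 5(1)] l2_coord[OF 5(2)]])
  then show ?case by (simp add: l2_inner flip: infsum_cnj)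
next
  case (6 f)
  then obtain n where "f n \<noteq> 0" by (auto simp: fun_eq_iff)
  then have "0 < hnorm H (f n)"
    using hnorm_eq_zero[OF l2_coord[OF 6(1)]] hnorm_nonneg[OF l2_coord[OF 6(1)]]
    by (metis order_le_imp_less_or_eq)
  also have "\<dots> \<le> hnorm (l2_space H) f" by (rule l2_coord_le[OF 6(1)])
  finally show ?case by (simp add: hnorm_def)
next
  case (7 s)
  then show ?case by (rule l2_complete)
qed

end

text \<open>
  The shift is oriented so that its powers move entries with positive index towards index zero.
\<close>

definition shift :: "(int \<Rightarrow> 'v) \<Rightarrow> (int \<Rightarrow> 'v)" where
  "shift f = (\<lambda>n. f (n + 1))"

lemma shift_funpow: "(shift ^^ k) f n = f (n + int k)"
  by (induction k arbitrary: n) (auto simp: shift_def ac_simps)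

lemma (in complex_hilbert_space) l2_shift_unitary:
  "unitary_operator (l2_space H) (shift :: (int \<Rightarrow> 'v) \<Rightarrow> _)"
proof -
  have bij: "bij_betw (\<lambda>n. n + k) (UNIV :: int set) UNIV" for k
    by (rule bij_betwI[of _ _ _ "\<lambda>n. n - k"]) auto
  have translate: "(\<lambda>n. f (n + k)) \<in> hcarrier (l2_space H)"
    if "f \<in> hcarrier (l2_space H)" for f :: "int \<Rightarrow> 'v" and k
    using that summable_on_reindex_bij_betw[OF bij[of k], of "\<lambda>n. (hnorm H (f n))\<^sup>2"]
    by (simp add: l2_mem)
  have "shift ` hcarrier (l2_space H) = hcarrier (l2_space H)"
  proof
    show "shift ` hcarrier (l2_space H) \<subseteq> hcarrier (l2_space H)"
      using translate by (auto simp: shift_def)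
    show "hcarrier (l2_space H) \<subseteq> shift ` hcarrier (l2_space H)"
    proof
      fix f :: "int \<Rightarrow> 'v" assume "f \<in> hcarrier (l2_space H)"
      then have "(\<lambda>n. f (n - 1)) \<in> hcarrier (l2_space H)"
        using translate[of f "- 1"] by simp
      moreover have "shift (\<lambda>n. f (n - 1)) = f" by (simp add: shift_def)
      ultimately show "f \<in> shift ` hcarrier (l2_space H)" by force
    qed
  qed
  moreover have "hinner (l2_space H) (shift f) (shift g) = hinner (l2_space H) f g"
    for f g :: "int \<Rightarrow> 'v"
    using infsum_reindex_bij_betw[OF bij[of 1], of "\<lambda>n. hinner H (f n) (g n)"]
    by (simp add: l2_inner shift_def)
  ultimately show ?thesis
    using translate
    by (auto simp: unitary_operator_def isometric_embedding_def hlinear_def shift_def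
        l2_scale_apply fun_eq_iff)
qed


section \<open>Dilations and their moments\<close>

lemma isometric_embeddingD:
  assumes "isometric_embedding H K J"
  shows "x \<in> hcarrier H \<Longrightarrow> J x \<in> hcarrier K"
    and "x \<in> hcarrier H \<Longrightarrow> y \<in> hcarrier H \<Longrightarrow> J (x + y) = J x + J y"
    and "x \<in> hcarrier H \<Longrightarrow> J (hscale H c x) = hscale K c (J x)"
    and "x \<in> hcarrier H \<Longrightarrow> y \<in> hcarrier H \<Longrightarrow> hinner K (J x) (J y) = hinner H x y"
  using assms by (auto simp: isometric_embedding_def hlinear_def)

lemma unitary_funpow_mem:
  assumes "unitary_operator K U" and "x \<in> hcarrier K"
  shows "(U ^^ n) x \<in> hcarrier K"
  using assms by (induction n) (auto simp: unitary_operator_def)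

lemma funpow_mem:
  assumes "\<And>x. x \<in> S \<Longrightarrow> T x \<in> S" and "x \<in> S"
  shows "(T ^^ n) x \<in> S"
  using assms by (induction n) auto

context complex_hilbert_space
begin

text \<open>
  Pairing with a vector of the embedded copy of \<open>H\<close> does not see the projection, so that the
  dilation equation becomes a statement about inner products alone.
\<close>

lemma rho_dilation_moment:
  assumes dil: "rho_dilation H \<rho> T K J U P" and T: "\<And>x. x \<in> hcarrier H \<Longrightarrow> T x \<in> hcarrier H"
    and h: "h \<in> hcarrier H" and g: "g \<in> hcarrier H" and n: "n \<ge> 1"
  shows "hinner H ((T ^^ n) h) g = of_real \<rho> * hinner K ((U ^^ n) (J h)) (J g)"
proof -
  from dil have K: "complex_hilbert_space K" and J: "isometric_embedding H K J"
    and U: "unitary_operator K U" and P: "orthogonal_projection K (J ` hcarrier H) P"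
    and eq: "J ((T ^^ n) h) = hscale K (complex_of_real \<rho>) (P ((U ^^ n) (J h)))"
    using h n by (auto simp: rho_dilation_def)
  interpret K: complex_hilbert_space K by (rule K)
  note Jc = isometric_embeddingD(1)[OF J]
  let ?x = "(U ^^ n) (J h)"
  have x: "?x \<in> hcarrier K" by (intro unitary_funpow_mem[OF U] Jc h)
  from P x have Pim: "P ?x \<in> J ` hcarrier H" and "hinner K (?x - P ?x) (J g) = 0"
    using g by (auto simp: orthogonal_projection_def)
  moreover have Px: "P ?x \<in> hcarrier K" using Pim Jc by auto
  ultimately have "hinner K (P ?x) (J g) = hinner K ?x (J g)"
    using x Jc[OF g] by (simp add: K.inner_diff)
  moreover have "hinner H ((T ^^ n) h) g = hinner K (J ((T ^^ n) h)) (J g)"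
    using isometric_embeddingD(4)[OF J funpow_mem[of "hcarrier H" T, OF T h] g] by simp
  ultimately show ?thesis
    using Px Jc[OF g] by (simp add: eq K.inner_scale)
qed

text \<open>
  Conversely, when the embedding has an adjoint, \<open>J\<close> followed by its adjoint is the orthogonal
  projection onto the embedded copy of \<open>H\<close>, and a vector of \<open>H\<close> is determined by its inner
  products; hence the moments are all that a dilation has to match.
\<close>

lemma rho_dilation_if_moments:
  fixes K :: "'k::ab_group_add hspace"
  assumes K: "complex_hilbert_space K" and J: "isometric_embedding H K J"
    and U: "unitary_operator K U"
    and T: "\<And>x. x \<in> hcarrier H \<Longrightarrow> T x \<in> hcarrier H" and \<rho>: "\<rho> \<noteq> 0"
    and Jadj: "\<And>f. f \<in> hcarrier K \<Longrightarrow> Jadj f \<in> hcarrier H"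
    and adj: "\<And>f h. f \<in> hcarrier K \<Longrightarrow> h \<in> hcarrier H \<Longrightarrow> hinner H (Jadj f) h = hinner K f (J h)"
    and moment: "\<And>h g n. h \<in> hcarrier H \<Longrightarrow> g \<in> hcarrier H \<Longrightarrow> n \<ge> 1 \<Longrightarrow>
      hinner H ((T ^^ n) h) g = of_real \<rho> * hinner K ((U ^^ n) (J h)) (J g)"
  shows "rho_dilation H \<rho> T K J U (\<lambda>f. J (Jadj f))"
proof -
  interpret K: complex_hilbert_space K by (rule K)
  note Jc = isometric_embeddingD(1)[OF J]
  have "orthogonal_projection K (J ` hcarrier H) (\<lambda>f. J (Jadj f))"
    unfolding orthogonal_projection_def
    using isometric_embeddingD(4)[OF J]
    by (auto simp: Jadj Jc K.inner_diff adj)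
  moreover have "J ((T ^^ n) h) = hscale K (of_real \<rho>) (J (Jadj ((U ^^ n) (J h))))"
    if h: "h \<in> hcarrier H" and n: "n \<ge> 1" for h n
  proof -
    let ?x = "(U ^^ n) (J h)"
    have x: "?x \<in> hcarrier K" by (intro unitary_funpow_mem[OF U] Jc h)
    have "(T ^^ n) h = hscale H (of_real \<rho>) (Jadj ?x)"
      using funpow_mem[of "hcarrier H" T, OF T h]
      by (intro eq_if_inner_eq) (auto simp: scale_mem Jadj x inner_scale adj moment[OF h _ n])
    then show ?thesis
      using isometric_embeddingD(3)[OF J] Jadj x by simp
  qed
  ultimately show ?thesis
    using K J U by (auto simp: rho_dilation_def)
qed

lemma rank_one_mem: "b \<in> hcarrier H \<Longrightarrow> rank_one H a b x \<in> hcarrier H"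
  by (simp add: rank_one_def scale_mem)

lemma rank_one_funpow:
  assumes "a \<in> hcarrier H" "b \<in> hcarrier H" "x \<in> hcarrier H"
  shows "(rank_one H a b ^^ Suc n) x = hscale H (hinner H b a ^ n * hinner H x a) b"
proof (induction n)
  case (Suc n)
  show ?case
    unfolding funpow.simps(2)[of "Suc n"] o_apply Suc.IH
    using assms by (simp add: rank_one_def inner_scale ac_simps)
qed (simp add: rank_one_def)

lemma rank_one_bounded:
  assumes a: "a \<in> hcarrier H" and b: "b \<in> hcarrier H"
  shows "bounded_operator H (rank_one H a b)"
proof -
  have "hnorm H (rank_one H a b x) \<le> (hnorm H a * hnorm H b) * hnorm H x" if x: "x \<in> hcarrier H" for x
    using mult_right_mono[OF cauchy_schwarz[OF x a] hnorm_nonneg[OF b]]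
    by (simp add: rank_one_def hnorm_scale b mult_ac)
  then show ?thesis
    using a b unfolding bounded_operator_def hlinear_def
    by (auto simp: rank_one_def scale_mem inner_add inner_scale scale_simps)
qed

lemma scale_rank_one:
  "hscale H c (rank_one H a b x) = rank_one H a (hscale H c b) x"
  by (simp add: rank_one_def scale_simps mult.commute)

end


section \<open>A dilation of a rank one operator\<close>

text \<open>
  The quadratic equation arises from completing the square in \<open>factor_defect\<close>, with
  \<open>p = \<parallel>a\<parallel>\<close>, \<open>q = \<parallel>b\<parallel>\<close> and \<open>m = \<bar>\<langle>b,a\<rangle>\<bar>\<close>.  Put \<open>\<nu> = p q / \<rho>\<close> and let \<open>- S\<close> be the linear
  coefficient.  The discriminant is \<open>S\<^sup>2 - 4 \<nu>\<^sup>2\<close>, and \<open>S > 2 \<nu>\<close> means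
  \<open>(1 - \<nu>)\<^sup>2 > m\<^sup>2 (1 - 1 / \<rho>)\<^sup>2\<close>, which is the hypothesis on \<open>p\<close>, \<open>q\<close> and \<open>m\<close> squared.
\<close>

lemma smaller_root:
  fixes p q m \<rho> :: real
  assumes nonneg: "0 \<le> p" "0 \<le> q" "0 \<le> m" and \<rho>: "0 < \<rho>"
    and small: "p * q + \<bar>1 - \<rho>\<bar> * m < \<rho>"
  obtains X where "0 \<le> X" "X * p\<^sup>2 < 1"
    "p\<^sup>2 * X\<^sup>2 - (1 + (p * q / \<rho>)\<^sup>2 - m\<^sup>2 * (1 - 1 / \<rho>)\<^sup>2) * X + (q / \<rho>)\<^sup>2 = 0"
proof -
  define \<nu> where "\<nu> = p * q / \<rho>"
  define S where "S = 1 + \<nu>\<^sup>2 - m\<^sup>2 * (1 - 1 / \<rho>)\<^sup>2"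
  define D where "D = sqrt (S\<^sup>2 - 4 * \<nu>\<^sup>2)"
  \<comment> \<open>This expression for the smaller root remains valid when \<open>p = 0\<close>.\<close>
  define X where "X = 2 * (q / \<rho>)\<^sup>2 / (S + D)"
  have \<nu>0: "0 \<le> \<nu>" using nonneg \<rho> by (simp add: \<nu>_def)
  have "m * \<bar>1 - 1 / \<rho>\<bar> = m * \<bar>1 - \<rho>\<bar> / \<rho>"
    using \<rho> by (simp add: abs_if field_simps)
  then have less: "m * \<bar>1 - 1 / \<rho>\<bar> < 1 - \<nu>"
    using small \<rho> by (simp add: \<nu>_def field_simps abs_minus_commute)
  then have "(m * \<bar>1 - 1 / \<rho>\<bar>)\<^sup>2 < (1 - \<nu>)\<^sup>2"
    using nonneg by (intro power_strict_mono) auto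
  then have S: "2 * \<nu> < S" by (simp add: S_def power_mult_distrib power2_diff)
  have "0 \<le> m * \<bar>1 - 1 / \<rho>\<bar>" using nonneg by simp
  then have \<nu>1: "\<nu> < 1" using less by linarith
  have "(2 * \<nu>)\<^sup>2 \<le> S\<^sup>2" using S \<nu>0 by (intro power_mono) auto
  then have D: "0 \<le> D" "D\<^sup>2 = S\<^sup>2 - 4 * \<nu>\<^sup>2" by (auto simp: D_def power_mult_distrib)
  have pos: "0 < S + D" using S \<nu>0 D by linarith
  have pX: "X * p\<^sup>2 = 2 * \<nu>\<^sup>2 / (S + D)"
    by (simp add: X_def \<nu>_def power_mult_distrib power_divide)
  have "2 * \<nu>\<^sup>2 = \<nu> * (2 * \<nu>)" by (simp add: power2_eq_square)
  also have "\<dots> \<le> 2 * \<nu>" using \<nu>0 \<nu>1 by (simp add: mult_left_le_one_le)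
  also have "\<dots> < S + D" using S D by linarith
  finally have "X * p\<^sup>2 < 1" using pos by (simp add: pX)
  moreover have "0 \<le> X" using pos by (simp add: X_def)
  moreover have "p\<^sup>2 * X\<^sup>2 - S * X + (q / \<rho>)\<^sup>2 = 0"
  proof -
    define Y where "Y = (q / \<rho>)\<^sup>2"
    define E where "E = S + D"
    have E: "E > 0" and XE: "X = 2 * Y / E" using pos by (simp_all add: E_def X_def Y_def)
    have pY: "p\<^sup>2 * Y = \<nu>\<^sup>2" by (simp add: Y_def \<nu>_def power_mult_distrib power_divide)
    have "p\<^sup>2 * X\<^sup>2 - S * X + Y = Y * (4 * (p\<^sup>2 * Y) - 2 * S * E + E\<^sup>2) / E\<^sup>2"
      using E by (simp add: XE field_simps power2_eq_square)
    also have "4 * (p\<^sup>2 * Y) - 2 * S * E + E\<^sup>2 = 0"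
      unfolding pY using D(2) by (simp add: E_def algebra_simps power2_eq_square)
    finally show ?thesis by (simp add: Y_def)
  qed
  ultimately show ?thesis using that by (simp add: S_def \<nu>_def)
qed

context complex_hilbert_space
begin

text \<open>
  In terms of \<open>R = I - \<sigma> (a \<otimes> a)\<close>, the three equations say
  \<open>\<parallel>R h + s e\<parallel>\<^sup>2 = \<parallel>h\<parallel>\<^sup>2 + (2 / \<rho>) Re (s \<langle>b,h\<rangle>) - X (\<bar>c s + \<langle>h,a\<rangle>\<bar>\<^sup>2 - \<bar>s\<bar>\<^sup>2)\<close> for all \<open>h\<close> and
  \<open>s\<close>, where \<open>c = \<langle>b,a\<rangle>\<close>.  Here \<open>R\<close> is the positive square root of \<open>I - X (a \<otimes> a)\<close>, which is
  invertible because \<open>X \<parallel>a\<parallel>\<^sup>2 < 1\<close>.  The cross term forces \<open>e = R\<^sup>-\<^sup>1 (b / \<rho> - X c a)\<close>, and then the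
  condition on \<open>\<parallel>e\<parallel>\<^sup>2\<close> is the quadratic equation for \<open>X\<close>.
\<close>

lemma factor_defect:
  assumes a: "a \<in> hcarrier H" and b: "b \<in> hcarrier H" and \<rho>: "0 < \<rho>"
    and small: "hnorm H a * hnorm H b + \<bar>1 - \<rho>\<bar> * cmod (hinner H b a) < \<rho>"
  obtains X :: real and \<sigma> :: real and e where "e \<in> hcarrier H"
    "\<And>x y. x \<in> hcarrier H \<Longrightarrow> y \<in> hcarrier H \<Longrightarrow>
      hinner H (x - hscale H (\<sigma> * hinner H x a) a) (y - hscale H (\<sigma> * hinner H y a) a)
      = hinner H x y - X * hinner H x a * hinner H a y"
    "\<And>y. y \<in> hcarrier H \<Longrightarrow> hinner H e (y - hscale H (\<sigma> * hinner H y a) a)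
      = hinner H b y / \<rho> - X * hinner H b a * hinner H a y"
    "hinner H e e = X * (1 - (cmod (hinner H b a))\<^sup>2)"
proof -
  define c where "c = hinner H b a"
  define A where "A = (hnorm H a)\<^sup>2"
  define B where "B = (hnorm H b)\<^sup>2"
  define t where "t = (cmod c)\<^sup>2"
  obtain X where X: "0 \<le> X" "X * A < 1"
    "A * X\<^sup>2 - (1 + A * B / \<rho>\<^sup>2 - t * (1 - 1 / \<rho>)\<^sup>2) * X + B / \<rho>\<^sup>2 = 0"
    using smaller_root[OF hnorm_nonneg[OF a] hnorm_nonneg[OF b] norm_ge_zero \<rho> small]
    unfolding A_def B_def t_def c_def by (auto simp: power_mult_distrib power_divide)
  \<comment> \<open>\<open>\<kappa>\<close> is the eigenvalue of \<open>R\<close> on the span of \<open>a\<close>.\<close>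
  define \<kappa> where "\<kappa> = sqrt (1 - X * A)"
  have \<kappa>: "0 < \<kappa>" "\<kappa>\<^sup>2 = 1 - X * A" using X by (auto simp: \<kappa>_def)
  define \<sigma> where "\<sigma> = X / (1 + \<kappa>)"
  have \<sigma>X: "\<sigma> * (1 + \<kappa>) = X" using \<kappa> by (simp add: \<sigma>_def)
  have "(1 + \<kappa>) * (\<sigma> * A) = (1 + \<kappa>) * (1 - \<kappa>)"
    using \<kappa> \<sigma>X by (simp add: algebra_simps power2_eq_square)
  then have \<sigma>A: "\<sigma> * A = 1 - \<kappa>" using \<kappa> by simp
  \<comment> \<open>The coefficient of \<open>a\<close> in \<open>e\<close>, divided by \<open>c\<close>, that solves \<open>R e = b / \<rho> - X c a\<close>.\<close>
  define g where "g = (\<sigma> / \<rho> - X) / \<kappa>"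
  have g\<kappa>: "g * \<kappa> = \<sigma> / \<rho> - X" using \<kappa> by (simp add: g_def)
  define e where "e = hscale H (1 / \<rho>) b + hscale H (c * g) a"
  have aa: "hinner H a a = of_real A" "hinner H b b = of_real B"
    by (simp_all add: A_def B_def inner_self a b)
  have ab: "hinner H a b = cnj c" using inner_commute[OF a b] by (simp add: c_def)
  have e: "e \<in> hcarrier H" by (simp add: e_def add_mem scale_mem a b)
  show thesis
  proof (rule that[OF e])
    fix x y assume x: "x \<in> hcarrier H" and y: "y \<in> hcarrier H"
    have ya: "hinner H y a = cnj (hinner H a y)" by (rule inner_commute[OF y a])
    have 2: "\<sigma> * \<sigma> * A - 2 * \<sigma> = - X"
    proof -
      have "\<sigma> * \<sigma> * A - 2 * \<sigma> = \<sigma> * (\<sigma> * A) - 2 * \<sigma>" by simp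
      also have "\<dots> = - (\<sigma> * (1 + \<kappa>))" unfolding \<sigma>A by (simp add: algebra_simps)
      finally show ?thesis by (simp only: \<sigma>X)
    qed
    have "hinner H (x - hscale H (\<sigma> * hinner H x a) a) (y - hscale H (\<sigma> * hinner H y a) a)
        = hinner H x y + of_real (\<sigma> * \<sigma> * A - 2 * \<sigma>) * hinner H x a * hinner H a y"
      by (simp add: x y a scale_mem diff_mem inner_diff inner_diff_right inner_scale
          inner_scale_right aa ya algebra_simps)
    then show "hinner H (x - hscale H (\<sigma> * hinner H x a) a) (y - hscale H (\<sigma> * hinner H y a) a)
        = hinner H x y - X * hinner H x a * hinner H a y"
      unfolding 2 by simp
  next
    fix y assume y: "y \<in> hcarrier H"
    have ya: "hinner H y a = cnj (hinner H a y)" by (rule inner_commute[OF y a])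
    have "g - \<sigma> * (1 / \<rho> + g * A) = g * (1 - \<sigma> * A) - \<sigma> / \<rho>"
      by (simp add: algebra_simps)
    also have "\<dots> = - X" using g\<kappa> by (simp add: \<sigma>A)
    finally have 3: "g - \<sigma> * (1 / \<rho> + g * A) = - X" .
    have "hinner H e (y - hscale H (\<sigma> * hinner H y a) a)
        = hinner H b y / \<rho> + of_real (g - \<sigma> * (1 / \<rho> + g * A)) * c * hinner H a y"
      by (simp add: e_def y a b scale_mem diff_mem add_mem inner_add inner_diff_right inner_scale
          inner_scale_right aa ya algebra_simps flip: c_def)
    then show "hinner H e (y - hscale H (\<sigma> * hinner H y a) a)
        = hinner H b y / \<rho> - X * hinner H b a * hinner H a y"
      unfolding 3 by (simp add: c_def)
  next
    define r where "r = 1 / \<rho>"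
    have X3: "A * X\<^sup>2 - (1 + A * B * r\<^sup>2 - t * (1 - r)\<^sup>2) * X + B * r\<^sup>2 = 0"
      using X(3) by (simp add: r_def power_divide)
    have gr: "g * \<kappa> = \<sigma> * r - X" using g\<kappa> by (simp add: r_def)
    \<comment> \<open>Multiplying by \<open>\<kappa>\<^sup>2 = 1 - X A\<close> clears the denominator of \<open>g\<close>.\<close>
    have "\<kappa>\<^sup>2 * (2 * g * r + g\<^sup>2 * A) = 2 * \<kappa> * (g * \<kappa>) * r + (g * \<kappa>)\<^sup>2 * A"
      by (simp add: algebra_simps power2_eq_square)
    also have "\<dots> = \<sigma> * (2 * \<kappa> + \<sigma> * A) * r\<^sup>2 - 2 * X * (\<sigma> * A + \<kappa>) * r + A * X\<^sup>2"
      unfolding gr by (simp add: algebra_simps power2_eq_square)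
    also have "\<dots> = X * r\<^sup>2 - 2 * X * r + A * X\<^sup>2"
      using \<sigma>X by (simp add: \<sigma>A add.commute)
    finally have 5: "\<kappa>\<^sup>2 * (2 * g * r + g\<^sup>2 * A) = X * r\<^sup>2 - 2 * X * r + A * X\<^sup>2" .
    have "\<kappa>\<^sup>2 * (B * r\<^sup>2 + t * (2 * g * r + g\<^sup>2 * A))
        = \<kappa>\<^sup>2 * (B * r\<^sup>2) + t * (\<kappa>\<^sup>2 * (2 * g * r + g\<^sup>2 * A))"
      by (simp add: algebra_simps)
    also have "\<dots> = (1 - X * A) * (B * r\<^sup>2) + t * (X * r\<^sup>2 - 2 * X * r + A * X\<^sup>2)"
      by (simp only: 5) (simp only: \<kappa>(2))
    also have "\<dots> = (1 - X * A) * (X * (1 - t))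
        + (A * X\<^sup>2 - (1 + A * B * r\<^sup>2 - t * (1 - r)\<^sup>2) * X + B * r\<^sup>2)"
      by (simp add: algebra_simps power2_eq_square)
    finally have "\<kappa>\<^sup>2 * (B * r\<^sup>2 + t * (2 * g * r + g\<^sup>2 * A)) = \<kappa>\<^sup>2 * (X * (1 - t))"
      unfolding X3 \<kappa>(2) by simp
    then have 4: "B * r\<^sup>2 + t * (2 * g * r + g\<^sup>2 * A) = X * (1 - t)"
      using \<kappa>(1) by simp
    have cc: "c * cnj c = of_real t" by (simp only: t_def complex_norm_square)
    have "hinner H e e = of_real r * of_real r * of_real B + of_real r * of_real g * (c * cnj c)
        + of_real r * of_real g * (c * cnj c) + of_real g * of_real g * of_real A * (c * cnj c)"
      by (simp add: e_def r_def a b scale_mem add_mem inner_add inner_add_right inner_scale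
          inner_scale_right aa ab algebra_simps flip: c_def)
    also have "\<dots> = of_real (B * r\<^sup>2 + t * (2 * g * r + g\<^sup>2 * A))"
      unfolding cc by (simp add: algebra_simps power2_eq_square)
    finally show "hinner H e e = X * (1 - (cmod (hinner H b a))\<^sup>2)"
      unfolding 4 by (simp add: t_def c_def)
  qed
qed

end

lemma geometric_has_sum:
  fixes z C :: complex
  assumes "cmod z < 1"
  shows "((\<lambda>k. z ^ k * C) has_sum (C / (1 - z))) UNIV"
proof (rule norm_summable_imp_has_sum)
  show "summable (\<lambda>k. norm (z ^ k * C))"
    using assms by (simp add: norm_mult norm_power summable_mult2)
  show "(\<lambda>k. z ^ k * C) sums (C / (1 - z))"
    using sums_mult2[OF geometric_sums[OF assms], of C] by simp
qed

lemma has_sum_positive_int: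
  assumes zero: "\<And>n::int. n \<le> 0 \<Longrightarrow> f n = 0"
    and sum: "((\<lambda>k. f (int k + 1)) has_sum s) UNIV"
  shows "(f has_sum s) UNIV"
proof -
  have "(f has_sum s) (range (\<lambda>k. int k + 1))"
    using sum by (subst has_sum_reindex) (auto simp: inj_on_def o_def)
  moreover have "f n = 0" if "n \<notin> range (\<lambda>k. int k + 1)" for n
  proof (rule zero, rule ccontr)
    assume "\<not> n \<le> 0"
    then have "n = int (nat (n - 1)) + 1" by simp
    with that show False by blast
  qed
  ultimately show ?thesis
    using has_sum_cong_neutral[of UNIV "range (\<lambda>k. int k + 1)" f f s] by simp
qed

definition delta :: "'v::zero \<Rightarrow> int \<Rightarrow> 'v" where
  "delta v = (\<lambda>n. if n = 0 then v else 0)"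

definition geometric_tail :: "'v::ab_group_add hspace \<Rightarrow> complex \<Rightarrow> 'v \<Rightarrow> int \<Rightarrow> 'v" where
  "geometric_tail H c e = (\<lambda>n. if 1 \<le> n then hscale H (c ^ nat (n - 1)) e else 0)"

context complex_hilbert_space
begin

lemma delta_mem: "v \<in> hcarrier H \<Longrightarrow> delta v \<in> hcarrier (l2_space H)"
  by (auto simp: l2_mem delta_def zero_mem hnorm_zero
      intro!: finite_nonzero_values_imp_summable_on finite_subset[of _ "{0}"] split: if_splits)

lemma inner_delta:
  assumes f: "f \<in> hcarrier (l2_space H)"
  shows "hinner (l2_space H) f (delta v) = hinner H (f 0) v"
proof -
  have "(\<Sum>\<^sub>\<infinity>n. hinner H (f n) (delta v n)) = (\<Sum>\<^sub>\<infinity>n\<in>{0}. hinner H (f n) (delta v n))"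
    by (rule infsum_cong_neutral) (auto simp: delta_def inner_zero_right l2_coord[OF f])
  then show ?thesis by (simp add: l2_inner delta_def)
qed

lemma geometric_tail_mem:
  assumes e: "e \<in> hcarrier H" and c: "cmod c < 1"
  shows "geometric_tail H c e \<in> hcarrier (l2_space H)"
proof -
  have "((\<lambda>k. ((cmod c)\<^sup>2) ^ k * (hnorm H e)\<^sup>2) has_sum ((hnorm H e)\<^sup>2 / (1 - (cmod c)\<^sup>2))) UNIV"
    using c by (intro sums_nonneg_imp_has_sum)
      (use sums_mult2[OF geometric_sums, of "(cmod c)\<^sup>2" "(hnorm H e)\<^sup>2"] in
        \<open>auto simp: abs_square_less_1\<close>)
  moreover have "(hnorm H (geometric_tail H c e (int k + 1)))\<^sup>2 = ((cmod c)\<^sup>2) ^ k * (hnorm H e)\<^sup>2" for k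
    by (simp add: geometric_tail_def hnorm_scale e norm_power power_mult_distrib
        flip: power_mult) (simp add: mult.commute)
  ultimately have "((\<lambda>n. (hnorm H (geometric_tail H c e n))\<^sup>2)
      has_sum ((hnorm H e)\<^sup>2 / (1 - (cmod c)\<^sup>2))) UNIV"
    by (intro has_sum_positive_int) (auto simp: geometric_tail_def hnorm_zero)
  then show ?thesis
    by (auto simp: l2_mem geometric_tail_def zero_mem scale_mem e dest: has_sum_imp_summable)
qed

text \<open>
  The sequence \<open>J h\<close> has the entry \<open>R h\<close> at zero and \<open>c\<^sup>n \<langle>h,a\<rangle> e\<close> at \<open>n + 1\<close>; it is square
  summable because the strict inequality forces \<open>\<bar>c\<bar> < 1\<close>.  In \<open>\<langle>U\<^sup>n J h, J g\<rangle>\<close> the entries at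
  positive indices contribute a geometric series with sum \<open>X c\<^sup>n \<langle>h,a\<rangle> \<langle>a,g\<rangle>\<close>, which cancels the
  \<open>X\<close>-terms that \<open>factor_defect\<close> leaves in the entry at zero.  What remains is \<open>\<langle>h,g\<rangle>\<close> for \<open>n = 0\<close>
  and \<open>c\<^sup>n\<^sup>-\<^sup>1 \<langle>h,a\<rangle> \<langle>b,g\<rangle> / \<rho> = \<langle>T\<^sup>n h, g\<rangle> / \<rho>\<close> for \<open>n \<ge> 1\<close>.
\<close>

lemma rank_one_rho_contraction:
  assumes a: "a \<in> hcarrier H" and b: "b \<in> hcarrier H" and \<rho>: "0 < \<rho>"
    and small: "hnorm H a * hnorm H b + \<bar>1 - \<rho>\<bar> * cmod (hinner H b a) < \<rho>"
  shows "rho_contraction H \<rho> (rank_one H a b)"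
proof -
  let ?L = "l2_space H :: (int \<Rightarrow> 'v) hspace"
  interpret L: complex_hilbert_space ?L by (rule l2_hilbert)
  define c where "c = hinner H b a"
  obtain X \<sigma> :: real and e where e: "e \<in> hcarrier H"
    and defect: "\<And>x y. x \<in> hcarrier H \<Longrightarrow> y \<in> hcarrier H \<Longrightarrow>
      hinner H (x - hscale H (\<sigma> * hinner H x a) a) (y - hscale H (\<sigma> * hinner H y a) a)
      = hinner H x y - X * hinner H x a * hinner H a y"
    and cross: "\<And>y. y \<in> hcarrier H \<Longrightarrow> hinner H e (y - hscale H (\<sigma> * hinner H y a) a)
      = hinner H b y / \<rho> - X * c * hinner H a y"
    and ee: "hinner H e e = X * (1 - (cmod c)\<^sup>2)"
    using factor_defect[OF a b \<rho> small] unfolding c_def by metis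
  have c1: "cmod c < 1"
  proof (rule ccontr)
    assume "\<not> cmod c < 1"
    then have "1 \<le> cmod c" by simp
    then have "\<bar>1 - \<rho>\<bar> * 1 \<le> \<bar>1 - \<rho>\<bar> * cmod c" by (intro mult_left_mono) auto
    moreover have "cmod c \<le> hnorm H a * hnorm H b"
      using cauchy_schwarz[OF b a] by (simp add: c_def mult.commute)
    ultimately show False using small \<open>1 \<le> cmod c\<close> by (simp add: c_def)
  qed
  define R where "R y = y - hscale H (\<sigma> * hinner H y a) a" for y
  have R: "R y \<in> hcarrier H" if "y \<in> hcarrier H" for y
    using that by (simp add: R_def diff_mem scale_mem a)
  have R_self: "hinner H (R x) y = hinner H x (R y)" if x: "x \<in> hcarrier H" and y: "y \<in> hcarrier H" for x y
    using inner_commute[OF y a]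
    by (simp add: R_def x y a scale_mem inner_diff inner_diff_right inner_scale inner_scale_right)
  define G where "G = geometric_tail H c e"
  have G: "G \<in> hcarrier ?L" unfolding G_def using e c1 by (rule geometric_tail_mem)
  define J where "J h = delta (R h) + hscale ?L (hinner H h a) G" for h
  define Jadj where "Jadj f = R (f 0) + hscale H (hinner ?L f G) a" for f
  have J: "J h \<in> hcarrier ?L" if "h \<in> hcarrier H" for h
    using that by (simp add: J_def L.add_mem L.scale_mem delta_mem R G)
  have Jadj: "Jadj f \<in> hcarrier H" if "f \<in> hcarrier ?L" for f
    using that by (simp add: Jadj_def add_mem scale_mem R a l2_coord)
  have innerJ: "hinner ?L f (J h) = hinner H (f 0) (R h) + hinner ?L f G * hinner H a h"
    if f: "f \<in> hcarrier ?L" and h: "h \<in> hcarrier H" for f h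
    using inner_commute[OF a h]
    by (simp add: J_def f h G R L.scale_mem delta_mem L.inner_add_right L.inner_scale_right inner_delta
        mult.commute)
  have adj: "hinner H (Jadj f) h = hinner ?L f (J h)" if f: "f \<in> hcarrier ?L" and h: "h \<in> hcarrier H" for f h
    by (simp add: innerJ f h Jadj_def R l2_coord[OF f] a scale_mem inner_add inner_scale R_self)
  have J_pos: "J h (int k + 1) = hscale H (hinner H h a * c ^ k) e" for h k
    by (simp add: J_def delta_def G_def geometric_tail_def l2_scale_apply scale_simps)
  have tail: "hinner ?L ((shift ^^ n) (J h)) G = X * c ^ n * hinner H h a"
    if h: "h \<in> hcarrier H" for h n
  proof -
    have cc: "c * cnj c = of_real ((cmod c)\<^sup>2)" by (simp only: complex_norm_square)
    have t1: "(cmod c)\<^sup>2 < 1" using c1 by (simp add: abs_square_less_1)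
    have "((\<lambda>k. (c * cnj c) ^ k * (hinner H h a * c ^ n * hinner H e e)) has_sum
        (hinner H h a * c ^ n * hinner H e e / (1 - c * cnj c))) UNIV"
      using t1 by (intro geometric_has_sum) (simp add: cc norm_power)
    moreover have "hinner H (J h (int k + 1 + int n)) (G (int k + 1))
        = (c * cnj c) ^ k * (hinner H h a * c ^ n * hinner H e e)" for k
    proof -
      have "J h (int k + 1 + int n) = hscale H (hinner H h a * c ^ (k + n)) e"
        using J_pos[of h "k + n"] by (simp add: ac_simps)
      then show ?thesis
        by (simp add: G_def geometric_tail_def e scale_mem inner_scale inner_scale_right
            power_add power_mult_distrib ac_simps)
    qed
    ultimately have "((\<lambda>m. hinner H ((shift ^^ n) (J h) m) (G m)) has_sum
        (hinner H h a * c ^ n * hinner H e e / (1 - c * cnj c))) UNIV"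
      using l2_coord[OF J[OF h]]
      by (intro has_sum_positive_int)
        (auto simp: shift_funpow G_def geometric_tail_def inner_zero_right)
    moreover have "hinner H h a * c ^ n * hinner H e e / (1 - c * cnj c) = X * c ^ n * hinner H h a"
    proof -
      define s where "s = 1 - (cmod c)\<^sup>2"
      have "1 - c * cnj c = of_real s" unfolding cc s_def by simp
      moreover have "s \<noteq> 0" using t1 by (simp add: s_def)
      moreover have "hinner H e e = of_real X * of_real s" unfolding ee s_def by simp
      ultimately show ?thesis by simp
    qed
    ultimately show ?thesis unfolding l2_inner by (simp add: infsumI)
  qed
  have isometric: "isometric_embedding H ?L J"
    unfolding isometric_embedding_def hlinear_def
  proof (intro conjI ballI allI)
    fix x y z assume x: "x \<in> hcarrier H" and y: "y \<in> hcarrier H"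
    show "J x \<in> hcarrier ?L" using x by (rule J)
    have "R (x + y) = R x + R y"
      by (simp add: R_def inner_add x y a scale_simps algebra_simps)
    then show "J (x + y) = J x + J y"
      by (auto simp: J_def inner_add x y a L.scale_simps delta_def fun_eq_iff)
    have "R (hscale H z x) = hscale H z (R x)"
      by (simp add: R_def inner_scale x a scale_simps mult_ac)
    then show "J (hscale H z x) = hscale ?L z (J x)"
      by (auto simp: J_def inner_scale x a L.scale_simps l2_scale_apply scale_simps delta_def fun_eq_iff)
    have "J x 0 = R x"
      by (simp add: J_def delta_def G_def geometric_tail_def l2_scale_apply scale_simps)
    then have "hinner ?L (J x) (J y) = hinner H (R x) (R y) + hinner ?L (J x) G * hinner H a y"
      using innerJ[OF J[OF x] y] by simp
    also have "\<dots> = hinner H x y"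
      using tail[OF x, of 0] defect[OF x y] by (simp add: R_def)
    finally show "hinner ?L (J x) (J y) = hinner H x y" .
  qed
  have moment: "hinner H ((rank_one H a b ^^ n) h) g = of_real \<rho> * hinner ?L ((shift ^^ n) (J h)) (J g)"
    if h: "h \<in> hcarrier H" and g: "g \<in> hcarrier H" and n: "n \<ge> 1" for h g n
  proof -
    obtain k where k: "n = Suc k" using n by (cases n) auto
    have x: "(shift ^^ n) (J h) \<in> hcarrier ?L"
      by (intro unitary_funpow_mem[OF l2_shift_unitary] J h)
    have x0: "(shift ^^ n) (J h) 0 = hscale H (hinner H h a * c ^ k) e"
      using J_pos[of h k] by (simp only: shift_funpow k) (simp add: add.commute)
    have "hinner ?L ((shift ^^ n) (J h)) (J g)
        = hinner H h a * c ^ k * hinner H e (R g) + X * c ^ n * hinner H h a * hinner H a g"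
      unfolding innerJ[OF x g] x0 tail[OF h] by (simp add: inner_scale e R g)
    also have "\<dots> = c ^ k * hinner H h a * hinner H b g / \<rho>"
      unfolding R_def cross[OF g] k by (simp add: algebra_simps)
    finally show ?thesis
      using \<rho> rank_one_funpow[OF a b h, of k] by (simp add: k inner_scale b g c_def)
  qed
  have "rho_dilation H \<rho> (rank_one H a b) ?L J shift (\<lambda>f. J (Jadj f))"
    by (rule rho_dilation_if_moments[OF l2_hilbert isometric l2_shift_unitary])
      (use \<rho> in \<open>auto simp: rank_one_mem b Jadj adj moment\<close>)
  then show ?thesis by (rule rho_contractionI[OF rank_one_bounded[OF a b]])
qed

end


section \<open>Positivity forced by a dilation\<close>

context complex_hilbert_space
begin

text \<open>
  For \<open>g = (I - z U)\<^sup>-\<^sup>1 x\<close> one has \<open>Re \<langle>(I + z U) g, (I - z U) g\<rangle> = \<parallel>g\<parallel>\<^sup>2 - \<parallel>z U g\<parallel>\<^sup>2 \<ge> 0\<close>, and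
  the left-hand side is \<open>2 Re \<langle>g,x\<rangle> - \<parallel>x\<parallel>\<^sup>2\<close>, where \<open>\<langle>g,x\<rangle>\<close> is a geometric series.  The proof
  works with the partial sums of the Neumann series for \<open>g\<close>; the truncation error is of order
  \<open>\<bar>z\<bar>\<^sup>M\<close>.
\<close>

lemma unitary_moments_positive:
  fixes q c z :: complex
  assumes U: "unitary_operator H U" and x: "x \<in> hcarrier H"
    and moment: "\<And>n. hinner H ((U ^^ Suc n) x) x = c ^ n * q"
    and c: "cmod c \<le> 1" and z: "cmod z < 1"
  shows "0 \<le> (hnorm H x)\<^sup>2 + 2 * Re (q * (z / (1 - c * z)))"
proof -
  note iso = U[unfolded unitary_operator_def, THEN conjunct1]
  note Uc = isometric_embeddingD(1)[OF iso]
  define v where "v n = (U ^^ n) x" for n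
  have v: "v n \<in> hcarrier H" for n
    unfolding v_def using U x by (rule unitary_funpow_mem)
  have normU: "hnorm H (U y) = hnorm H y" if "y \<in> hcarrier H" for y
    using isometric_embeddingD(4)[OF iso that that] by (simp add: hnorm_def)
  have normv: "hnorm H (v n) = hnorm H x" for n
    by (induction n) (use v in \<open>auto simp: v_def normU\<close>)
  define g where "g = rec_nat x (\<lambda>M y. y + hscale H (z ^ Suc M) (v (Suc M)))"
  have g_simps: "g 0 = x" "g (Suc M) = g M + hscale H (z ^ Suc M) (v (Suc M))" for M
    by (simp_all add: g_def)
  have g: "g M \<in> hcarrier H" for M
    by (induction M) (simp_all add: g_simps x v add_mem scale_mem del: power_Suc)
  have telescope: "g M - hscale H z (U (g M)) = x - hscale H (z ^ Suc M) (v (Suc M))" for M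
  proof (induction M)
    case 0
    show ?case by (simp add: g_simps v_def)
  next
    case (Suc M)
    have vU: "v (Suc (Suc M)) = U (v (Suc M))" by (simp add: v_def)
    have "U (g (Suc M)) = U (g M) + hscale H (z ^ Suc M) (v (Suc (Suc M)))"
      using isometric_embeddingD(2)[OF iso g[of M] scale_mem[OF v]]
        isometric_embeddingD(3)[OF iso v]
      by (simp add: g_simps vU)
    then have "g (Suc M) - hscale H z (U (g (Suc M)))
        = (g M - hscale H z (U (g M))) + hscale H (z ^ Suc M) (v (Suc M))
          - hscale H (z ^ Suc (Suc M)) (v (Suc (Suc M)))"
      by (simp add: g_simps scale_simps algebra_simps)
    then show ?case by (simp add: Suc.IH)
  qed
  have inner_g: "hinner H (g M) x = of_real ((hnorm H x)\<^sup>2) + q * z * (\<Sum>k<M. (c * z) ^ k)" for M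
  proof (induction M)
    case 0
    show ?case by (simp add: g_simps inner_self x)
  next
    case (Suc M)
    have "hinner H (g (Suc M)) x = hinner H (g M) x + z ^ Suc M * (c ^ M * q)"
      using moment[of M, folded v_def]
      by (simp add: g_simps inner_add inner_scale g v x scale_mem del: power_Suc)
    then show ?case unfolding Suc.IH by (simp add: algebra_simps power_mult_distrib)
  qed
  define r where "r = cmod z"
  have r: "0 \<le> r" "r < 1" using z by (auto simp: r_def)
  have norm_g: "hnorm H (g M) \<le> hnorm H x / (1 - r)" for M
  proof -
    have "hnorm H (g M) \<le> hnorm H x * (\<Sum>k<Suc M. r ^ k)"
    proof (induction M)
      case (Suc M)
      have "hnorm H (g (Suc M)) \<le> hnorm H (g M) + r ^ Suc M * hnorm H x"
        using hnorm_triangle[OF g[of M] scale_mem[OF v[of "Suc M"], where c = "z ^ Suc M"]]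
        by (simp add: g_simps hnorm_scale v normv norm_mult norm_power r_def)
      also have "\<dots> \<le> hnorm H x * (\<Sum>k<Suc M. r ^ k) + r ^ Suc M * hnorm H x"
        using Suc.IH by simp
      also have "\<dots> = hnorm H x * (\<Sum>k<Suc (Suc M). r ^ k)"
        by (simp add: algebra_simps)
      finally show ?case .
    qed (simp add: g_simps)
    also have "(\<Sum>k<Suc M. r ^ k) \<le> 1 / (1 - r)"
      unfolding sum_gp_strict using r by (auto intro!: divide_right_mono simp del: power_Suc)
    then have "hnorm H x * (\<Sum>k<Suc M. r ^ k) \<le> hnorm H x * (1 / (1 - r))"
      using hnorm_nonneg[OF x] by (rule mult_left_mono)
    finally show ?thesis by simp
  qed
  \<comment> \<open>The two summands bound the effect of the truncation on \<open>\<parallel>x\<parallel>\<^sup>2\<close> and on \<open>\<langle>g,x\<rangle>\<close>.\<close>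
  define C where "C = 2 * (hnorm H x)\<^sup>2 + 2 * (hnorm H x)\<^sup>2 / (1 - r)"
  have bound: "(hnorm H x)\<^sup>2 \<le> 2 * Re (hinner H (g M) x) + r ^ Suc M * C" for M
  proof -
    define \<epsilon> where "\<epsilon> = z ^ Suc M"
    define w where "w = v (Suc M)"
    define y where "y = x - hscale H \<epsilon> w"
    have w: "w \<in> hcarrier H" "hnorm H w = hnorm H x" by (simp_all add: w_def v normv)
    have y: "y \<in> hcarrier H" by (simp add: y_def x w scale_mem diff_mem)
    have eps: "cmod \<epsilon> = r ^ Suc M" by (simp add: \<epsilon>_def norm_power norm_mult r_def)
    have "hnorm H (g M - y) = r * hnorm H (g M)"
    proof -
      have "g M - y = hscale H z (U (g M))"
        using telescope[of M] by (simp add: y_def \<epsilon>_def w_def algebra_simps)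
      then show ?thesis by (simp add: hnorm_scale Uc g normU r_def)
    qed
    then have "(hnorm H (g M - y))\<^sup>2 \<le> (hnorm H (g M))\<^sup>2"
      using r hnorm_nonneg[OF g[of M]]
      by (intro power_mono) (auto simp: mult_left_le_one_le)
    moreover have "(hnorm H (g M - y))\<^sup>2
        = (hnorm H (g M))\<^sup>2 + (hnorm H y)\<^sup>2 - 2 * Re (hinner H (g M) y)"
      by (rule hnorm_diff_sq[OF g y])
    ultimately have 1: "(hnorm H y)\<^sup>2 \<le> 2 * Re (hinner H (g M) y)" by linarith
    have "(hnorm H y)\<^sup>2
        = (hnorm H x)\<^sup>2 + (hnorm H (hscale H \<epsilon> w))\<^sup>2 - 2 * Re (hinner H x (hscale H \<epsilon> w))"
      unfolding y_def by (rule hnorm_diff_sq[OF x scale_mem[OF w(1)]])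
    moreover have "Re (hinner H x (hscale H \<epsilon> w)) \<le> r ^ Suc M * (hnorm H x)\<^sup>2"
    proof -
      have "Re (hinner H x (hscale H \<epsilon> w)) \<le> hnorm H x * hnorm H (hscale H \<epsilon> w)"
        using complex_Re_le_cmod cauchy_schwarz[OF x scale_mem[OF w(1)]] by (rule order_trans)
      then show ?thesis by (simp only: hnorm_scale w eps power2_eq_square mult_ac)
    qed
    ultimately have 2: "(hnorm H x)\<^sup>2 - 2 * (r ^ Suc M * (hnorm H x)\<^sup>2) \<le> (hnorm H y)\<^sup>2"
      using zero_le_power2[of "hnorm H (hscale H \<epsilon> w)"] by linarith
    have "Re (hinner H (g M) y) = Re (hinner H (g M) x) - Re (cnj \<epsilon> * hinner H (g M) w)"
      by (simp add: y_def g x w scale_mem inner_diff_right inner_scale_right)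
    moreover have "- Re (cnj \<epsilon> * hinner H (g M) w) \<le> r ^ Suc M * ((hnorm H x)\<^sup>2 / (1 - r))"
    proof -
      have "- Re (cnj \<epsilon> * hinner H (g M) w) \<le> cmod (cnj \<epsilon>) * cmod (hinner H (g M) w)"
        unfolding norm_mult[symmetric] using abs_Re_le_cmod[of "cnj \<epsilon> * hinner H (g M) w"] by linarith
      also have "\<dots> \<le> r ^ Suc M * (hnorm H (g M) * hnorm H w)"
        unfolding complex_mod_cnj eps using cauchy_schwarz[OF g w(1)] r
        by (intro mult_left_mono) auto
      also have "\<dots> \<le> r ^ Suc M * (hnorm H x / (1 - r) * hnorm H x)"
        unfolding w(2) using norm_g[of M] hnorm_nonneg[OF x] r
        by (intro mult_left_mono mult_right_mono) auto
      finally show ?thesis by (simp add: power2_eq_square)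
    qed
    ultimately have "2 * Re (hinner H (g M) y)
        \<le> 2 * Re (hinner H (g M) x) + 2 * (r ^ Suc M * ((hnorm H x)\<^sup>2 / (1 - r)))"
      by linarith
    with 1 2 show ?thesis by (simp add: C_def algebra_simps)
  qed
  have cz: "cmod (c * z) < 1"
    using c z by (metis mult_left_le_one_le norm_ge_zero norm_mult order_le_less_trans)
  have "(\<lambda>M. 2 * Re (hinner H (g M) x) + r ^ Suc M * C) \<longlonglongrightarrow>
      2 * Re (of_real ((hnorm H x)\<^sup>2) + q * z * (1 / (1 - c * z))) + 0 * C"
    unfolding inner_g
    by (intro tendsto_intros LIMSEQ_Suc[OF LIMSEQ_power_zero] geometric_sums[OF cz, unfolded sums_def])
      (use r in auto)
  then have "(hnorm H x)\<^sup>2 \<le> 2 * Re (of_real ((hnorm H x)\<^sup>2) + q * z * (1 / (1 - c * z))) + 0 * C"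
    by (rule LIMSEQ_le_const) (use bound in blast)
  then show ?thesis by simp
qed

text \<open>
  With \<open>P = \<parallel>a\<parallel> \<parallel>w b\<parallel>\<close> and \<open>\<kappa> = \<langle>w b,a\<rangle>\<close>, which is real by the choice of \<open>z\<close>, positivity at
  \<open>h = \<parallel>w b\<parallel> a - \<parallel>a\<parallel> w b\<close> becomes \<open>P (P - \<kappa>) (\<rho> - (P - \<kappa>)) \<ge> 0\<close>, hence \<open>P - \<kappa> \<le> \<rho>\<close>.  This
  vector is an eigenvector of the real part of the operator \<open>x \<mapsto> \<langle>x,a\<rangle> w b\<close>, for its least
  eigenvalue.  For \<open>\<bar>z\<bar> = r\<close> and \<open>c z = s\<close> the inequality is
  \<open>r \<parallel>a\<parallel> \<parallel>b\<parallel> \<le> \<rho> + (1 - \<rho>) s\<close>, which is sharpest when \<open>s\<close> has the sign of \<open>\<rho> - 1\<close>.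
\<close>

lemma rho_contraction_rank_one_bound:
  assumes a: "a \<in> hcarrier H" and b: "b \<in> hcarrier H" and \<rho>: "0 < \<rho>"
    and contraction: "rho_contraction H \<rho> (rank_one H a b)"
  shows "hnorm H a * hnorm H b + \<bar>1 - \<rho>\<bar> * cmod (hinner H b a) \<le> \<rho>"
proof -
  obtain K :: "(int \<Rightarrow> 'v \<Rightarrow> complex) hspace" and J U P
    where dil: "rho_dilation H \<rho> (rank_one H a b) K J U P"
    using contraction by (auto simp: rho_contraction_def)
  then have K: "complex_hilbert_space K" and iso: "isometric_embedding H K J"
    and U: "unitary_operator K U"
    by (auto simp: rho_dilation_def)
  interpret K: complex_hilbert_space K by (rule K)
  note J = isometric_embeddingD(1)[OF iso]
  have normJ: "hnorm K (J h) = hnorm H h" if "h \<in> hcarrier H" for h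
    using isometric_embeddingD(4)[OF iso that that] by (simp add: hnorm_def)
  define c where "c = hinner H b a"
  have moment: "hinner K ((U ^^ Suc n) (J h)) (J g) = c ^ n * (hinner H h a * hinner H b g / \<rho>)"
    if h: "h \<in> hcarrier H" and g: "g \<in> hcarrier H" for n h g
    using rho_dilation_moment[OF dil rank_one_mem[OF b] h g, of "Suc n"] \<rho>
      rank_one_funpow[OF a b h, of n]
    by (simp add: inner_scale b g c_def field_simps)
  \<comment> \<open>The powers of the operator are bounded by \<open>\<rho>\<close>, so its eigenvalue \<open>c\<close> has modulus at most \<open>1\<close>.\<close>
  have c1: "cmod c \<le> 1"
  proof (rule ccontr)
    assume "\<not> cmod c \<le> 1"
    then have c: "1 < cmod c" by simp
    then have "b \<noteq> 0" using inner_zero[OF a] by (auto simp: c_def)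
    then have B: "0 < (hnorm H b)\<^sup>2" using inner_pos[OF b] by (simp add: hnorm_sq b)
    obtain n where n: "\<rho> < cmod c ^ n" using real_arch_pow[OF c] by blast
    have "cmod (hinner K ((U ^^ Suc n) (J b)) (J b)) \<le> hnorm K ((U ^^ Suc n) (J b)) * hnorm K (J b)"
      by (intro K.cauchy_schwarz unitary_funpow_mem[OF U] J b)
    also have "hnorm K ((U ^^ m) (J b)) = hnorm K (J b)" for m
    proof (induction m)
      case (Suc m)
      have "(U ^^ m) (J b) \<in> hcarrier K" by (intro unitary_funpow_mem[OF U] J b)
      with Suc show ?case
        using isometric_embeddingD(4)[of K K U] U by (simp add: unitary_operator_def hnorm_def)
    qed simp
    also have "cmod (hinner K ((U ^^ Suc n) (J b)) (J b)) = cmod c ^ Suc n * (hnorm H b)\<^sup>2 / \<rho>"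
      using \<rho> unfolding moment[OF b b]
      by (simp add: norm_mult norm_divide norm_power inner_self[OF b] flip: c_def)
    finally have "cmod c ^ Suc n * (hnorm H b)\<^sup>2 \<le> \<rho> * (hnorm H b)\<^sup>2"
      using \<rho> by (simp add: normJ b power2_eq_square field_simps)
    then have "cmod c ^ Suc n \<le> \<rho>" using B by simp
    moreover have "cmod c ^ n \<le> cmod c ^ Suc n" using c by (intro power_increasing) auto
    ultimately show False using n by linarith
  qed
  have key: "0 \<le> (hnorm H h)\<^sup>2 + 2 * Re (hinner H h a * hinner H b h / \<rho> * (z / (1 - c * z)))"
    if h: "h \<in> hcarrier H" and z: "cmod z < 1" for h z
    using K.unitary_moments_positive[OF U J[OF h] moment[OF h h] c1 z] by (simp add: normJ h)
  define \<epsilon> :: real where "\<epsilon> = (if 1 \<le> \<rho> then 1 else - 1)"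
  have \<epsilon>: "\<bar>\<epsilon>\<bar> = 1" "(1 - \<rho>) * \<epsilon> = - \<bar>1 - \<rho>\<bar>" by (auto simp: \<epsilon>_def)
  define N where "N = hnorm H a * hnorm H b"
  have N: "0 \<le> N" using hnorm_nonneg a b by (simp add: N_def)
  have cN: "cmod c \<le> N" using cauchy_schwarz[OF b a] by (simp add: c_def N_def mult.commute)
  \<comment> \<open>The point \<open>z\<close> will be \<open>\<epsilon> r \<zeta>\<close>, for which \<open>c z = \<epsilon> r \<bar>c\<bar>\<close> is real.\<close>
  obtain \<zeta> where \<zeta>: "cmod \<zeta> = 1" "c * \<zeta> = of_real (cmod c)"
  proof (cases "c = 0")
    case True
    then show ?thesis using that[of 1] by simp
  next
    case False
    have "c * (cnj c / of_real (cmod c)) = of_real (cmod c)"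
      using False by (simp add: complex_norm_square[symmetric] power2_eq_square)
    then show ?thesis using that[of "cnj c / of_real (cmod c)"] False by (simp add: norm_divide)
  qed
  have "r * (N + \<bar>1 - \<rho>\<bar> * cmod c) \<le> \<rho>" if r: "0 < r" "r < 1" for r
  proof -
    define s where "s = \<epsilon> * r * cmod c"
    define w where "w = of_real (\<epsilon> * r / (1 - s)) * \<zeta>"
    have "\<bar>s\<bar> \<le> r" using \<epsilon>(1) r c1 by (simp add: s_def abs_mult mult_left_le)
    then have s: "s < 1" "\<bar>s\<bar> < 1" using r by auto
    have cz: "c * (of_real (\<epsilon> * r) * \<zeta>) = of_real s"
      using \<zeta>(2) by (simp add: s_def mult.left_commute[of c])
    have wz: "of_real (\<epsilon> * r) * \<zeta> / (1 - c * (of_real (\<epsilon> * r) * \<zeta>)) = w"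
      unfolding cz by (simp add: w_def)
    have norm_z: "cmod (of_real (\<epsilon> * r) * \<zeta>) < 1"
      using r by (simp add: norm_mult \<zeta> abs_mult \<epsilon>)
    define W where "W = r / (1 - s)"
    have W0: "0 \<le> W" using r s by (simp add: W_def)
    have "cmod w = \<bar>\<epsilon> * r / (1 - s)\<bar>"
      by (simp only: w_def norm_mult \<zeta>(1) norm_of_real mult_1_right)
    also have "\<dots> = W" using r s \<epsilon>(1) by (simp add: W_def abs_mult)
    finally have W: "cmod w = W" .
    define \<kappa> where "\<kappa> = s / (1 - s)"
    have wc: "w * c = of_real \<kappa>"
    proof -
      have "w * c = c * (of_real (\<epsilon> * r) * \<zeta>) / of_real (1 - s)" by (simp add: w_def)
      then show ?thesis unfolding cz \<kappa>_def by simp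
    qed
    have wc': "cnj w * cnj c = of_real \<kappa>" using arg_cong[OF wc, of cnj] by simp
    have ww: "w * cnj w = of_real (W\<^sup>2)" by (simp only: W[symmetric] complex_norm_square)
    define A where "A = hnorm H a"
    define B where "B = hnorm H b"
    have NAB: "N = A * B" by (simp add: N_def A_def B_def)
    define P where "P = W * N"
    have P: "0 \<le> P" using W0 N by (simp add: P_def)
    have aa: "hinner H a a = of_real (A\<^sup>2)" "hinner H b b = of_real (B\<^sup>2)"
      "hinner H b a = c" "hinner H a b = cnj c"
      using inner_commute[OF a b] by (simp_all add: inner_self a b A_def B_def c_def)
    define h where "h = hscale H (of_real (W * B)) a - hscale H (of_real A * w) b"
    have h: "h \<in> hcarrier H" by (simp add: h_def a b scale_mem diff_mem)
    have ha: "hinner H h a = of_real (A * (P - \<kappa>))"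
    proof -
      have "hinner H h a = of_real (W * B * A\<^sup>2) - of_real A * (w * c)"
        by (simp add: h_def a b scale_mem inner_diff inner_scale aa)
      then show ?thesis unfolding wc by (simp add: P_def NAB algebra_simps power2_eq_square)
    qed
    have hb: "w * hinner H b h = - of_real (W * B * (P - \<kappa>))"
    proof -
      have "w * hinner H b h = of_real (W * B) * (w * c) - of_real (A * B\<^sup>2) * (w * cnj w)"
        by (simp add: h_def a b scale_mem inner_diff_right inner_scale_right aa algebra_simps)
      then show ?thesis unfolding wc ww by (simp add: P_def NAB algebra_simps power2_eq_square)
    qed
    have "hinner H h h = of_real (W * B) * hinner H a h - of_real A * (w * hinner H b h)"
      by (subst (1) h_def) (simp add: a b h scale_mem inner_diff inner_scale mult.assoc)
    also have "hinner H a h = cnj (hinner H h a)" by (rule inner_commute[OF a h])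
    finally have "hinner H h h = of_real (2 * P * (P - \<kappa>))"
      unfolding ha hb by (simp add: P_def NAB algebra_simps)
    then have hh: "(hnorm H h)\<^sup>2 = 2 * P * (P - \<kappa>)" by (simp only: hnorm_sq[OF h] Re_complex_of_real)
    have "hinner H h a * hinner H b h / \<rho> * w = hinner H h a * (w * hinner H b h) / \<rho>"
      by simp
    also have "\<dots> = of_real (- P * (P - \<kappa>)\<^sup>2 / \<rho>)"
      unfolding ha hb by (simp add: P_def NAB algebra_simps power2_eq_square)
    finally have "0 \<le> 2 * P * (P - \<kappa>) + 2 * (- P * (P - \<kappa>)\<^sup>2 / \<rho>)"
      using key[OF h norm_z] unfolding wz hh by (simp only: Re_complex_of_real)
    also have "\<dots> = 2 * P * (P - \<kappa>) * (\<rho> - (P - \<kappa>)) / \<rho>"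
      using \<rho> by (simp add: field_simps power2_eq_square)
    finally have nonneg: "0 \<le> P * (P - \<kappa>) * (\<rho> - (P - \<kappa>))"
      using \<rho> by (simp add: zero_le_divide_iff)
    have "P - \<kappa> \<le> \<rho>"
    proof (cases "P = 0 \<or> P - \<kappa> \<le> 0")
      case True
      then show ?thesis
      proof
        assume "P = 0"
        then have "N = 0" using r s by (auto simp: P_def W_def)
        then have "\<kappa> = 0" using cN by (simp add: \<kappa>_def s_def)
        then show ?thesis using \<open>P = 0\<close> \<rho> by simp
      qed (use \<rho> in linarith)
    next
      case False
      then have "0 < P * (P - \<kappa>)" using P by auto
      then show ?thesis using nonneg by (simp add: zero_le_mult_iff)
    qed
    then have "(P - \<kappa>) * (1 - s) \<le> \<rho> * (1 - s)" using s by (intro mult_right_mono) auto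
    moreover have "P - \<kappa> = (r * N - s) / (1 - s)"
      by (simp add: P_def W_def \<kappa>_def diff_divide_distrib)
    then have "(P - \<kappa>) * (1 - s) = r * N - s" using s by simp
    ultimately have "r * N \<le> \<rho> + ((1 - \<rho>) * \<epsilon>) * (r * cmod c)"
      by (simp add: s_def algebra_simps)
    then show ?thesis unfolding \<epsilon>(2) by (simp add: algebra_simps)
  qed
  then show ?thesis unfolding N_def c_def by (rule field_le_mult_one_interval)
qed

end

section \<open>The numerical radius as an infimum\<close>

theorem theorem2p2:
  fixes H :: "'v::ab_group_add hspace" and a b :: 'v and \<rho> :: real
  assumes "complex_hilbert_space H"
    and "a \<in> hcarrier H" and "b \<in> hcarrier H"
    and "\<rho> > 0"
  shows "rho_numerical_radius H \<rho> (rank_one H a b) =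
    1 / \<rho> * hnorm H a * hnorm H b + \<bar>1 - 1 / \<rho>\<bar> * cmod (hinner H a b)"
proof -
  interpret complex_hilbert_space H by (rule assms)
  note a = assms(2) and b = assms(3) and \<rho> = assms(4)
  define S where
    "S = {u. 0 < u \<and> rho_contraction H \<rho> (\<lambda>x. hscale H (complex_of_real (1 / u)) (rank_one H a b x))}"
  define D where "D = hnorm H a * hnorm H b + \<bar>1 - \<rho>\<bar> * cmod (hinner H a b)"
  have D: "0 \<le> D" using hnorm_nonneg a b by (simp add: D_def)
  have scaled: "hnorm H a * hnorm H (hscale H (of_real (1 / u)) b)
      + \<bar>1 - \<rho>\<bar> * cmod (hinner H (hscale H (of_real (1 / u)) b) a) = D / u" if "0 < u" for u
  proof -
    have "cmod (hinner H b a) = cmod (hinner H a b)"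
      using inner_commute[OF b a] by simp
    then show ?thesis
      using that a b by (simp add: D_def hnorm_scale inner_scale norm_divide add_divide_distrib)
  qed
  have lower: "D / \<rho> \<le> u" if "u \<in> S" for u
  proof -
    have u: "0 < u" and con: "rho_contraction H \<rho> (rank_one H a (hscale H (of_real (1 / u)) b))"
      using that by (simp_all add: S_def scale_rank_one)
    have "D / u \<le> \<rho>"
      using rho_contraction_rank_one_bound[OF a scale_mem[OF b] \<rho> con] unfolding scaled[OF u] .
    then show ?thesis using u \<rho> by (simp add: field_simps)
  qed
  have upper: "u \<in> S" if "D / \<rho> < u" for u
  proof -
    have "0 \<le> D / \<rho>" using D \<rho> by simp
    then have u: "0 < u" using that by linarith
    have "D / u < \<rho>" using that u \<rho> by (simp add: field_simps)
    then have "rho_contraction H \<rho> (rank_one H a (hscale H (of_real (1 / u)) b))"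
      using scaled[OF u] by (intro rank_one_rho_contraction[OF a scale_mem[OF b] \<rho>]) simp
    then show ?thesis using u by (simp add: S_def scale_rank_one)
  qed
  have "Inf S = D / \<rho>"
  proof (rule cInf_eq_non_empty)
    show "S \<noteq> {}" using upper[of "D / \<rho> + 1"] by auto
    fix y assume y: "\<And>u. u \<in> S \<Longrightarrow> y \<le> u"
    show "y \<le> D / \<rho>" by (rule dense_ge) (use y upper in blast)
  qed (rule lower)
  moreover have "rho_numerical_radius H \<rho> (rank_one H a b) = Inf S"
    by (simp add: rho_numerical_radius_def S_def)
  moreover have "\<bar>1 - 1 / \<rho>\<bar> = \<bar>1 - \<rho>\<bar> / \<rho>"
    using \<rho> by (simp add: abs_if field_simps)
  ultimately show ?thesis using \<rho> by (simp add: D_def add_divide_distrib)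
qed

end
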